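(* Let $\bar\varphi_0\in V_{\Delta x}$. For every minimizer $\{\tilde\alpha^n\}_{n=0}^{N-1}$ in the definition of $\tilde u(\bar\varphi_0,0)$ there exists a solution $\{\tilde\varphi^n\}_{n=0}^{N},\{\tilde\lambda^n\}_{n=0}^{N}\subset V_{\Delta x}$ of the Symplectic Euler system $$\begin{aligned} (\tilde\varphi^{n+1},v)&=(\tilde\varphi^n,v)+\Delta t\big(-\delta(\tilde\varphi^n_x,v_x)-\delta^{-1}(V'(\tilde\varphi^n),v)-(\tilde\lambda^{n+1},v)\big),\\ \tilde\varphi^0&=\bar\varphi_0,\\ (\tilde\lambda^n,v)&=(\tilde\lambda^{n+1},v)+\Delta t\big(-\delta(\tilde\lambda^{n+1}_x,v_x)-\delta^{-1}(\tilde\lambda^{n+1}V''(\tilde\varphi^n),v)\big),\\ \tilde\lambda^N&=2K(\tilde\varphi^N-P\varphi_-), \end{aligned}$$ (for all $v\in V_{\Delta x}$ and $0\le n\le N-1$) with $\tilde\lambda^{n+1}=-\tilde\alpha^n$ for $0\le n\le N-1$.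
   Context: Fix constants $\delta,T,K>0$. $\|\cdot\|$ and $(\cdot,\cdot)$ are the norm and inner product of $L^2(0,1)$. The potential $V:\mathbb R\to\mathbb R$ is smooth, equals $\frac14(\varphi^2-1)^2$ on an interval $[-s,s]$ ($s$ large), and is modified outside $[-s,s]$ so that $V',V'',V'''$ (and arbitrarily many further derivatives) are bounded on $\mathbb R$. $\varphi_-\in H_0^1(0,1)\cap H^2(0,1)$ is the negative one of the two stable critical points minimizing the energy $\int_0^1\big(\frac{\delta}{2}\varphi_x^2+\delta^{-1}V(\varphi)\big)dx$ under zero Dirichlet boundary conditions. Let $h(\alpha)=\|\alpha\|^2/2$ and $g(\varphi)=K\|\varphi-\varphi_-\|^2$. For $M\in\mathbb N$, $\Delta x=1/M$, $V_{\Delta x}$ is the space of continuous functions on $[0,1]$ that vanish at $0$ and $1$ and are linear on each interval $(i\Delta x,(i+1)\Delta x)$; $P$ is the $L^2$ projection onto $V_{\Delta x}$. With $N\in\mathbb N$, $\Delta t=T/N$, $t_n=n\Delta t$, the fully discrete value function is $$\tilde u(\tilde\varphi_0,t_m)=\min_{\{\tilde\alpha^n\}_{n=m}^{N-1}\subset V_{\Delta x}}\Big(g(\tilde\varphi^N)+\Delta t\sum_{n=m}^{N-1}h(\tilde\alpha^n)\Big),$$ where $\tilde\varphi^m=\tilde\varphi_0\in V_{\Delta x}$ and $\tilde\varphi^n\in V_{\Delta x}$ solves, for all $v\in V_{\Delta x}$, $$(\tilde\varphi^{n+1},v)=(\tilde\varphi^n,v)+\Delta t\big(-\delta(\tilde\varphi^n_x,v_x)+(-\delta^{-1}V'(\tilde\varphi^n)+\tilde\alpha^n,v)\big).$$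 *)

theory Defs
  imports "HOL-Analysis.Analysis"
begin

section \<open>The space \<open>L\<^sup>2(0,1)\<close>\<close>

text \<open>Functions on \<open>(0,1)\<close> are represented by functions \<open>real \<Rightarrow> real\<close>; only their values on
  \<open>[0,1]\<close>, up to null sets, enter the notions of this and the next two sections.\<close>

definition L2 :: "(real \<Rightarrow> real) set" where
  "L2 = {f. f \<in> borel_measurable (lebesgue_on {0..1}) \<and>
            integrable (lebesgue_on {0..1}) (\<lambda>x. (f x)\<^sup>2)}"

definition L2_inner :: "(real \<Rightarrow> real) \<Rightarrow> (real \<Rightarrow> real) \<Rightarrow> real" where
  "L2_inner f g = integral\<^sup>L (lebesgue_on {0..1}) (\<lambda>x. f x * g x)"

definition L2_norm :: "(real \<Rightarrow> real) \<Rightarrow> real" where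
  "L2_norm f = sqrt (L2_inner f f)"

section \<open>Sobolev spaces on \<open>(0,1)\<close>\<close>

definition smooth :: "(real \<Rightarrow> real) \<Rightarrow> bool" where
  "smooth f \<longleftrightarrow> (\<forall>k x. (deriv ^^ k) f field_differentiable (at x))"

definition test_functions :: "(real \<Rightarrow> real) set" where
  "test_functions = {\<psi>. smooth \<psi> \<and> (\<exists>a b. 0 < a \<and> b < 1 \<and> (\<forall>x. x \<notin> {a..b} \<longrightarrow> \<psi> x = 0))}"

definition has_weak_deriv :: "(real \<Rightarrow> real) \<Rightarrow> (real \<Rightarrow> real) \<Rightarrow> bool" where
  "has_weak_deriv f g \<longleftrightarrow> (\<forall>\<psi>\<in>test_functions. L2_inner f (deriv \<psi>) = - L2_inner g \<psi>)"

text \<open>A weak derivative is unique up to null sets, so the choice below is immaterial under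
  integrals.\<close>

definition weak_deriv :: "(real \<Rightarrow> real) \<Rightarrow> real \<Rightarrow> real" where
  "weak_deriv f = (SOME g. g \<in> L2 \<and> has_weak_deriv f g)"

definition H1 :: "(real \<Rightarrow> real) set" where
  "H1 = {f \<in> L2. \<exists>g\<in>L2. has_weak_deriv f g}"

definition H2 :: "(real \<Rightarrow> real) set" where
  "H2 = {f \<in> H1. weak_deriv f \<in> H1}"

text \<open>\<open>H\<^sub>0\<^sup>1(0,1)\<close> is the closure of the test functions in the \<open>H\<^sup>1\<close> norm.\<close>

definition H10 :: "(real \<Rightarrow> real) set" where
  "H10 = {f \<in> H1. \<exists>\<psi> :: nat \<Rightarrow> real \<Rightarrow> real. (\<forall>k. \<psi> k \<in> test_functions) \<and>
            (\<lambda>k. L2_norm (\<lambda>x. f x - \<psi> k x)) \<longlonglongrightarrow> 0 \<and>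
            (\<lambda>k. L2_norm (\<lambda>x. weak_deriv f x - deriv (\<psi> k) x)) \<longlonglongrightarrow> 0}"

section \<open>Potential, energy and target profile\<close>

text \<open>\<open>r\<close> is the number of derivatives of \<open>V\<close> that the modification outside \<open>[-s,s]\<close> keeps
  bounded.\<close>

definition modified_double_well :: "(real \<Rightarrow> real) \<Rightarrow> real \<Rightarrow> nat \<Rightarrow> bool" where
  "modified_double_well V s r \<longleftrightarrow>
     smooth V \<and>
     (\<forall>y\<in>{-s..s}. V y = 1/4 * (y\<^sup>2 - 1)\<^sup>2) \<and>
     (\<forall>k\<in>{1..r}. bounded (range ((deriv ^^ k) V)))"

definition energy :: "real \<Rightarrow> (real \<Rightarrow> real) \<Rightarrow> (real \<Rightarrow> real) \<Rightarrow> real" where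
  "energy \<delta> V \<phi> =
     integral\<^sup>L (lebesgue_on {0..1}) (\<lambda>x. \<delta>/2 * (weak_deriv \<phi> x)\<^sup>2 + 1/\<delta> * V (\<phi> x))"

definition critical_point :: "real \<Rightarrow> (real \<Rightarrow> real) \<Rightarrow> (real \<Rightarrow> real) \<Rightarrow> bool" where
  "critical_point \<delta> V \<phi> \<longleftrightarrow>
     \<phi> \<in> H10 \<and>
     (\<forall>v\<in>H10. \<delta> * L2_inner (weak_deriv \<phi>) (weak_deriv v)
               + 1/\<delta> * L2_inner (\<lambda>x. deriv V (\<phi> x)) v = 0)"

text \<open>Stability is not a separate clause: the critical point is required to be a global minimizer
  of the energy, which is stronger.\<close>

definition negative_minimizer :: "real \<Rightarrow> (real \<Rightarrow> real) \<Rightarrow> (real \<Rightarrow> real) \<Rightarrow> bool" where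
  "negative_minimizer \<delta> V \<phi> \<longleftrightarrow>
     \<phi> \<in> H10 \<inter> H2 \<and>
     critical_point \<delta> V \<phi> \<and>
     (\<forall>\<psi>\<in>H10. energy \<delta> V \<phi> \<le> energy \<delta> V \<psi>) \<and>
     (AE x in lebesgue_on {0..1}. \<phi> x < 0)"

section \<open>Finite elements\<close>

text \<open>Elements of \<open>fe_space M\<close> are extended by zero outside \<open>[0,1]\<close>, so that equality of
  elements is equality of functions. The spatial derivative of an element in the schemes below is
  \<^const>\<open>deriv\<close>; the nodes \<open>i/M\<close>, where it may be undefined, form a null set.\<close>

definition fe_space :: "nat \<Rightarrow> (real \<Rightarrow> real) set" where
  "fe_space M = {f. continuous_on {0..1} f \<and> f 0 = 0 \<and> f 1 = 0 \<and>
     (\<forall>i<M. \<exists>a b. \<forall>x\<in>{real i / real M<..<real (i + 1) / real M}. f x = a + b * x) \<and>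
     (\<forall>x. x \<notin> {0..1} \<longrightarrow> f x = 0)}"

definition L2_proj :: "nat \<Rightarrow> (real \<Rightarrow> real) \<Rightarrow> real \<Rightarrow> real" where
  "L2_proj M f = (THE p. p \<in> fe_space M \<and> (\<forall>v\<in>fe_space M. L2_inner p v = L2_inner f v))"

section \<open>The fully discrete control problem\<close>

definition running_cost :: "(real \<Rightarrow> real) \<Rightarrow> real" where
  "running_cost \<alpha> = (L2_norm \<alpha>)\<^sup>2 / 2"

definition terminal_cost :: "real \<Rightarrow> (real \<Rightarrow> real) \<Rightarrow> (real \<Rightarrow> real) \<Rightarrow> real" where
  "terminal_cost K \<phi>m \<phi> = K * (L2_norm (\<lambda>x. \<phi> x - \<phi>m x))\<^sup>2"

text \<open>\<open>discrete_state\<close>: \<open>\<phi>\<close> is the trajectory started in \<open>\<phi>\<^sub>0\<close> at time \<open>t\<^sub>m\<close> and driven by the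
  control \<open>\<alpha>\<close>. Sequences are functions on \<^typ>\<open>nat\<close> whose values outside the relevant index range
  (\<open>m..N\<close> for states, \<open>m..N-1\<close> for controls) are irrelevant.\<close>

definition discrete_state ::
  "real \<Rightarrow> real \<Rightarrow> (real \<Rightarrow> real) \<Rightarrow> nat \<Rightarrow> nat \<Rightarrow> nat \<Rightarrow> (real \<Rightarrow> real) \<Rightarrow>
   (nat \<Rightarrow> real \<Rightarrow> real) \<Rightarrow> (nat \<Rightarrow> real \<Rightarrow> real) \<Rightarrow> bool" where
  "discrete_state \<delta> T V M N m \<phi>0 \<alpha> \<phi> \<longleftrightarrow>
     \<phi> m = \<phi>0 \<and>
     (\<forall>n\<in>{m..N}. \<phi> n \<in> fe_space M) \<and>
     (\<forall>n\<in>{m..<N}. \<forall>v\<in>fe_space M.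
        L2_inner (\<phi> (n+1)) v = L2_inner (\<phi> n) v
          + T / real N * (- \<delta> * L2_inner (deriv (\<phi> n)) (deriv v)
               + L2_inner (\<lambda>x. - (1/\<delta>) * deriv V (\<phi> n x) + \<alpha> n x) v))"

definition discrete_cost ::
  "real \<Rightarrow> real \<Rightarrow> (real \<Rightarrow> real) \<Rightarrow> nat \<Rightarrow> nat \<Rightarrow>
   (nat \<Rightarrow> real \<Rightarrow> real) \<Rightarrow> (nat \<Rightarrow> real \<Rightarrow> real) \<Rightarrow> real" where
  "discrete_cost T K \<phi>m N m \<alpha> \<phi> =
     terminal_cost K \<phi>m (\<phi> N) + T / real N * (\<Sum>n=m..<N. running_cost (\<alpha> n))"

definition admissible ::
  "real \<Rightarrow> real \<Rightarrow> (real \<Rightarrow> real) \<Rightarrow> nat \<Rightarrow> nat \<Rightarrow> nat \<Rightarrow> (real \<Rightarrow> real) \<Rightarrow>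
   (nat \<Rightarrow> real \<Rightarrow> real) \<Rightarrow> (nat \<Rightarrow> real \<Rightarrow> real) \<Rightarrow> bool" where
  "admissible \<delta> T V M N m \<phi>0 \<alpha> \<phi> \<longleftrightarrow>
     (\<forall>n\<in>{m..<N}. \<alpha> n \<in> fe_space M) \<and> discrete_state \<delta> T V M N m \<phi>0 \<alpha> \<phi>"

definition discrete_value ::
  "real \<Rightarrow> real \<Rightarrow> real \<Rightarrow> (real \<Rightarrow> real) \<Rightarrow> (real \<Rightarrow> real) \<Rightarrow> nat \<Rightarrow> nat \<Rightarrow>
   (real \<Rightarrow> real) \<Rightarrow> nat \<Rightarrow> real" where
  "discrete_value \<delta> T K V \<phi>m M N \<phi>0 m =
     Inf {discrete_cost T K \<phi>m N m \<alpha> \<phi> | \<alpha> \<phi>. admissible \<delta> T V M N m \<phi>0 \<alpha> \<phi>}"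

text \<open>The trajectory is determined by the control on \<open>m..N\<close>, so minimizing over admissible pairs
  is minimizing over controls.\<close>

definition discrete_minimizer ::
  "real \<Rightarrow> real \<Rightarrow> real \<Rightarrow> (real \<Rightarrow> real) \<Rightarrow> (real \<Rightarrow> real) \<Rightarrow> nat \<Rightarrow> nat \<Rightarrow>
   (real \<Rightarrow> real) \<Rightarrow> nat \<Rightarrow> (nat \<Rightarrow> real \<Rightarrow> real) \<Rightarrow> bool" where
  "discrete_minimizer \<delta> T K V \<phi>m M N \<phi>0 m \<alpha> \<longleftrightarrow>
     (\<exists>\<phi>. admissible \<delta> T V M N m \<phi>0 \<alpha> \<phi> \<and>
          (\<forall>\<alpha>' \<phi>'. admissible \<delta> T V M N m \<phi>0 \<alpha>' \<phi>' \<longrightarrow>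
             discrete_cost T K \<phi>m N m \<alpha> \<phi> \<le> discrete_cost T K \<phi>m N m \<alpha>' \<phi>'))"

lemma discrete_minimizer_attains_value:
  assumes "discrete_minimizer \<delta> T K V \<phi>m M N \<phi>0 m \<alpha>"
  shows "\<exists>\<phi>. admissible \<delta> T V M N m \<phi>0 \<alpha> \<phi> \<and>
             discrete_cost T K \<phi>m N m \<alpha> \<phi> = discrete_value \<delta> T K V \<phi>m M N \<phi>0 m"
proof -
  from assms obtain \<phi> where adm: "admissible \<delta> T V M N m \<phi>0 \<alpha> \<phi>"
    and le: "\<And>\<alpha>' \<phi>'. admissible \<delta> T V M N m \<phi>0 \<alpha>' \<phi>' \<Longrightarrow>
             discrete_cost T K \<phi>m N m \<alpha> \<phi> \<le> discrete_cost T K \<phi>m N m \<alpha>' \<phi>'"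
    unfolding discrete_minimizer_def by blast
  have "discrete_value \<delta> T K V \<phi>m M N \<phi>0 m = discrete_cost T K \<phi>m N m \<alpha> \<phi>"
    unfolding discrete_value_def by (rule cInf_eq_minimum) (use adm le in blast)+
  with adm show ?thesis by auto
qed

section \<open>The Symplectic Euler system\<close>

text \<open>\<open>p\<close> is the dual variable, written \<open>\<lambda>\<close> in the literature (a keyword of HOL's syntax).\<close>

definition symplectic_euler ::
  "real \<Rightarrow> real \<Rightarrow> real \<Rightarrow> (real \<Rightarrow> real) \<Rightarrow> (real \<Rightarrow> real) \<Rightarrow> nat \<Rightarrow> nat \<Rightarrow>
   (real \<Rightarrow> real) \<Rightarrow> (nat \<Rightarrow> real \<Rightarrow> real) \<Rightarrow> (nat \<Rightarrow> real \<Rightarrow> real) \<Rightarrow> bool" where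
  "symplectic_euler \<delta> T K V \<phi>m M N \<phi>0 \<phi> p \<longleftrightarrow>
     (\<forall>n\<le>N. \<phi> n \<in> fe_space M \<and> p n \<in> fe_space M) \<and>
     (\<forall>n<N. \<forall>v\<in>fe_space M.
        L2_inner (\<phi> (n+1)) v = L2_inner (\<phi> n) v
          + T / real N * (- \<delta> * L2_inner (deriv (\<phi> n)) (deriv v)
               - 1/\<delta> * L2_inner (\<lambda>x. deriv V (\<phi> n x)) v
               - L2_inner (p (n+1)) v)) \<and>
     \<phi> 0 = \<phi>0 \<and>
     (\<forall>n<N. \<forall>v\<in>fe_space M.
        L2_inner (p n) v = L2_inner (p (n+1)) v
          + T / real N * (- \<delta> * L2_inner (deriv (p (n+1))) (deriv v)
               - 1/\<delta> * L2_inner (\<lambda>x. p (n+1) x * (deriv ^^ 2) V (\<phi> n x)) v)) \<and>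
     p N = (\<lambda>x. 2 * K * (\<phi> N x - L2_proj M \<phi>m x))"

end

theory Submission
  imports Defs
begin

text \<open>
  The system is the first-order optimality condition of the discrete control problem, and the
  adjoint equation comes out most directly if the trajectory, not the control, is varied. The
  scheme is explicit and the control enters it through the full space \<open>V\<^sub>\<Delta>\<^sub>x\<close>, so every sequence of
  states that starts in \<open>\<phi>\<^sub>0\<close> is driven by a unique control; states at positive times may be moved
  freely and independently of each other.

  Let \<open>(\<alpha>, \<phi>)\<close> be a minimizing pair and replace the single state \<open>\<phi>\<^sup>n\<close> by \<open>\<phi>\<^sup>n + \<epsilon> w\<close>. Only the controls
  at times \<open>n - 1\<close> and \<open>n\<close> have to react (\<open>perturbed_admissible\<close>): the first one by \<open>\<epsilon> w / \<Delta>t\<close>, the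
  second one by the amount that \<open>compensating_control\<close> expands to second order in \<open>\<epsilon>\<close>. For
  \<open>0 < n < N\<close> the terminal cost is unchanged, and the vanishing first variation of the running cost
  reads
  \<open>(\<alpha>\<^sup>n\<^sup>-\<^sup>1, w) = (\<alpha>\<^sup>n, w) - \<Delta>t (\<delta> (w\<^sub>x, \<alpha>\<^sup>n\<^sub>x) + \<delta>\<^sup>-\<^sup>1 (V''(\<phi>\<^sup>n) w, \<alpha>\<^sup>n))\<close>,
  which is the equation of the dual variable for \<open>\<lambda>\<^sup>n\<^sup>+\<^sup>1 = - \<alpha>\<^sup>n\<close> (\<open>stationarity_interior\<close>). For \<open>n = N\<close>
  it reads \<open>(\<alpha>\<^sup>N\<^sup>-\<^sup>1, w) = - 2 K (\<phi>\<^sup>N - \<phi>\<^sub>-, w)\<close>, which is the terminal condition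
  (\<open>stationarity_terminal\<close>). So \<open>\<lambda>\<^sup>n = - \<alpha>\<^sup>n\<^sup>-\<^sup>1\<close> solves the system at positive times, and \<open>\<lambda>\<^sup>0\<close> is
  obtained by solving the last remaining equation.

  All functionals of the test function that occur are represented by elements of \<open>V\<^sub>\<Delta>\<^sub>x\<close>
  (\<open>fe_space_riesz\<close>), since the space is finite-dimensional and a continuous function of zero
  \<open>L\<^sup>2\<close> norm vanishes.
\<close>

section \<open>The inner product on \<open>L\<^sup>2(0,1)\<close>\<close>

lemma integrable_L2_mult:
  assumes "f \<in> L2" "g \<in> L2"
  shows "integrable (lebesgue_on {0..1}) (\<lambda>x. f x * g x)"
proof (rule Bochner_Integration.integrable_bound)
  show "integrable (lebesgue_on {0..1}) (\<lambda>x. (f x)\<^sup>2 + (g x)\<^sup>2)"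
    using assms by (auto simp: L2_def)
  show "(\<lambda>x. f x * g x) \<in> borel_measurable (lebesgue_on {0..1})"
    using assms by (auto simp: L2_def)
  have "\<bar>a * b\<bar> \<le> a\<^sup>2 + b\<^sup>2" for a b :: real
  proof -
    have "0 \<le> (\<bar>a\<bar> - \<bar>b\<bar>)\<^sup>2" by simp
    then have "2 * (\<bar>a\<bar> * \<bar>b\<bar>) \<le> a\<^sup>2 + b\<^sup>2" by (simp add: power2_diff)
    moreover have "0 \<le> \<bar>a\<bar> * \<bar>b\<bar>" by simp
    ultimately show ?thesis unfolding abs_mult by linarith
  qed
  then show "AE x in lebesgue_on {0..1}. norm (f x * g x) \<le> norm ((f x)\<^sup>2 + (g x)\<^sup>2)"
    by simp
qed

lemma L2_lincomb:
  assumes "f \<in> L2" "g \<in> L2"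
  shows "(\<lambda>x. a * f x + b * g x) \<in> L2"
proof -
  have "(\<lambda>x. (a * f x + b * g x)\<^sup>2)
      = (\<lambda>x. a\<^sup>2 * (f x)\<^sup>2 + b\<^sup>2 * (g x)\<^sup>2 + 2 * a * b * (f x * g x))"
    by (rule ext) (simp add: power2_eq_square algebra_simps)
  with assms integrable_L2_mult[OF assms] show ?thesis
    by (auto simp: L2_def)
qed

lemma bounded_measurable_in_L2:
  assumes "f \<in> borel_measurable (lebesgue_on {0..1})" "\<And>x. x \<in> {0..1} \<Longrightarrow> \<bar>f x\<bar> \<le> C"
  shows "f \<in> L2"
proof -
  interpret finite_measure "lebesgue_on {0..1::real}"
    by (rule finite_measure_lebesgue_on) simp
  have "(f x)\<^sup>2 \<le> C\<^sup>2" if "x \<in> {0..1}" for x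
    using power_mono[OF assms(2)[OF that], of 2] by simp
  then have "integrable (lebesgue_on {0..1}) (\<lambda>x. (f x)\<^sup>2)"
    using assms(1) by (intro integrable_const_bound[where B = "C\<^sup>2"] AE_I2) auto
  with assms(1) show ?thesis by (simp add: L2_def)
qed

lemma L2_inner_commute: "L2_inner f g = L2_inner g f"
  by (simp add: L2_inner_def mult.commute)

lemma L2_inner_lincomb_left:
  assumes "f \<in> L2" "g \<in> L2" "h \<in> L2"
  shows "L2_inner (\<lambda>x. a * f x + b * g x) h = a * L2_inner f h + b * L2_inner g h"
proof -
  have "(\<lambda>x. (a * f x + b * g x) * h x) = (\<lambda>x. a * (f x * h x) + b * (g x * h x))"
    by (rule ext) (simp add: algebra_simps)
  then show ?thesis
    using integrable_L2_mult[OF assms(1,3)] integrable_L2_mult[OF assms(2,3)]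
    by (simp add: L2_inner_def)
qed

lemma L2_inner_lincomb_right:
  assumes "f \<in> L2" "g \<in> L2" "h \<in> L2"
  shows "L2_inner h (\<lambda>x. a * f x + b * g x) = a * L2_inner h f + b * L2_inner h g"
  using L2_inner_lincomb_left[OF assms] by (simp add: L2_inner_commute)

lemma L2_inner_self_nonneg: "0 \<le> L2_inner f f"
  by (simp add: L2_inner_def)

lemma L2_norm_power2: "(L2_norm f)\<^sup>2 = L2_inner f f"
  by (simp add: L2_norm_def L2_inner_self_nonneg)

lemma L2_inner_self_add:
  assumes "f \<in> L2" "g \<in> L2"
  shows "L2_inner (\<lambda>x. f x + c * g x) (\<lambda>x. f x + c * g x)
       = L2_inner f f + 2 * c * L2_inner f g + c\<^sup>2 * L2_inner g g"
proof -
  let ?h = "\<lambda>x. 1 * f x + c * g x"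
  have h: "?h \<in> L2" by (rule L2_lincomb[OF assms])
  have "L2_inner ?h ?h = L2_inner f f + 2 * c * L2_inner f g + c\<^sup>2 * L2_inner g g"
    unfolding L2_inner_lincomb_left[OF assms h] L2_inner_lincomb_right[OF assms assms(1)]
      L2_inner_lincomb_right[OF assms assms(2)] L2_inner_commute[of g f]
    by (simp add: power2_eq_square algebra_simps)
  then show ?thesis by simp
qed

lemma L2_inner_bound:
  assumes "f \<in> L2" "g \<in> L2" "0 \<le> C"
    and f: "\<And>x. x \<in> {0..1} \<Longrightarrow> \<bar>f x\<bar> \<le> C" and g: "\<And>x. x \<in> {0..1} \<Longrightarrow> \<bar>g x\<bar> \<le> D"
  shows "\<bar>L2_inner f g\<bar> \<le> C * D"
proof -
  interpret finite_measure "lebesgue_on {0..1::real}"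
    by (rule finite_measure_lebesgue_on) simp
  have int: "integrable (lebesgue_on {0..1}) (\<lambda>x. f x * g x)"
    by (rule integrable_L2_mult[OF assms(1,2)])
  have "\<bar>L2_inner f g\<bar> \<le> (\<integral>x. \<bar>f x * g x\<bar> \<partial>lebesgue_on {0..1})"
    unfolding L2_inner_def by (rule integral_abs_bound)
  also have "\<dots> \<le> (\<integral>x. C * D \<partial>lebesgue_on {0..1::real})"
  proof (rule Bochner_Integration.integral_mono)
    show "integrable (lebesgue_on {0..1}) (\<lambda>x. \<bar>f x * g x\<bar>)"
      using int by (rule integrable_abs)
    show "\<bar>f x * g x\<bar> \<le> C * D" if "x \<in> space (lebesgue_on {0..1})" for x
      using that f[of x] g[of x] \<open>0 \<le> C\<close> unfolding abs_mult by (intro mult_mono) auto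
  qed simp
  also have "\<dots> = C * D"
    by (simp add: measure_restrict_space)
  finally show ?thesis .
qed

section \<open>Riesz representation on finite-dimensional subspaces\<close>

definition function_subspace :: "(real \<Rightarrow> real) set \<Rightarrow> bool" where
  "function_subspace S \<longleftrightarrow> (\<lambda>x. 0) \<in> S \<and>
     (\<forall>f\<in>S. \<forall>g\<in>S. \<forall>a b. (\<lambda>x. a * f x + b * g x) \<in> S)"

definition linear_functional_on :: "(real \<Rightarrow> real) set \<Rightarrow> ((real \<Rightarrow> real) \<Rightarrow> real) \<Rightarrow> bool" where
  "linear_functional_on S F \<longleftrightarrow>
     (\<forall>f\<in>S. \<forall>g\<in>S. \<forall>a b. F (\<lambda>x. a * f x + b * g x) = a * F f + b * F g)"

text \<open>Finite dimensionality enters through a finite set \<open>X\<close> of points whose values determine the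
  elements of \<open>S\<close>. The induction on \<open>X\<close> is Gram--Schmidt: requiring
  the value at one point to vanish cuts out a subspace that is either everything or a hyperplane,
  and in the second case one vector orthogonal to the hyperplane corrects its representer.\<close>

lemma riesz_representation:
  assumes "finite X" "function_subspace S" "S \<subseteq> L2"
    and "\<And>f. f \<in> S \<Longrightarrow> L2_inner f f = 0 \<Longrightarrow> f = (\<lambda>x. 0)"
    and "\<And>f. f \<in> S \<Longrightarrow> (\<And>x. x \<in> X \<Longrightarrow> f x = 0) \<Longrightarrow> f = (\<lambda>x. 0)"
    and "linear_functional_on S F"
  shows "\<exists>z\<in>S. \<forall>v\<in>S. L2_inner z v = F v"
  using assms
proof (induction X arbitrary: S F rule: finite_induct)
  case empty
  have S: "S = {\<lambda>x. 0}"
    using empty.prems(1) empty.prems(4) unfolding function_subspace_def by auto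
  have "\<forall>a b. F (\<lambda>x. 0) = a * F (\<lambda>x. 0) + b * F (\<lambda>x. 0)"
    using empty.prems(5) S by (simp add: linear_functional_on_def)
  then have "F (\<lambda>x. 0) = 0" by (metis add_0 mult_zero_left)
  then show ?case using S by (simp add: L2_inner_def)
next
  case (insert a X)
  define S' where "S' = {f \<in> S. f a = 0}"
  have comb: "\<And>f g c d. f \<in> S \<Longrightarrow> g \<in> S \<Longrightarrow> (\<lambda>x. c * f x + d * g x) \<in> S"
    using insert.prems(1) by (auto simp: function_subspace_def)
  have lin: "\<And>f g c d. f \<in> S \<Longrightarrow> g \<in> S \<Longrightarrow> F (\<lambda>x. c * f x + d * g x) = c * F f + d * F g"
    using insert.prems(5) by (auto simp: linear_functional_on_def)
  have S'S: "S' \<subseteq> S" by (auto simp: S'_def)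
  have IH: "\<exists>z\<in>S'. \<forall>v\<in>S'. L2_inner z v = G v" if "linear_functional_on S' G" for G
  proof (rule insert.IH)
    show "function_subspace S'"
      using insert.prems(1) by (auto simp: function_subspace_def S'_def)
    show "S' \<subseteq> L2" using S'S insert.prems(2) by blast
    show "f = (\<lambda>x. 0)" if "f \<in> S'" "L2_inner f f = 0" for f
      using that S'S insert.prems(3) by blast
    show "f = (\<lambda>x. 0)" if "f \<in> S'" "\<And>x. x \<in> X \<Longrightarrow> f x = 0" for f
      using that insert.prems(4)[of f] by (auto simp: S'_def)
  qed (rule that)
  have "linear_functional_on S' F"
    using insert.prems(5) S'S by (auto simp: linear_functional_on_def)
  then obtain z where z: "z \<in> S'" "\<And>v. v \<in> S' \<Longrightarrow> L2_inner z v = F v"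
    using IH by blast
  show ?case
  proof (cases "S \<subseteq> S'")
    case True
    then show ?thesis using z S'S by blast
  next
    case False
    then obtain b where b: "b \<in> S" "b a \<noteq> 0" by (auto simp: S'_def)
    have L2: "\<And>f. f \<in> S \<Longrightarrow> f \<in> L2" using insert.prems(2) by blast
    have "linear_functional_on S' (L2_inner b)"
      using L2 S'S b by (auto simp: linear_functional_on_def intro!: L2_inner_lincomb_right)
    then obtain q where q: "q \<in> S'" "\<And>v. v \<in> S' \<Longrightarrow> L2_inner q v = L2_inner b v"
      using IH by blast
    \<comment> \<open>One Gram--Schmidt step: the component of \<open>b\<close> orthogonal to the hyperplane.\<close>
    define e where "e = (\<lambda>x. 1 * b x + (-1) * q x)"
    have qS: "q \<in> S" and zS: "z \<in> S" using q z S'S by auto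
    have eS: "e \<in> S" unfolding e_def by (rule comb[OF b(1) qS])
    have ea: "e a \<noteq> 0" using b q by (simp add: e_def S'_def)
    then have ee: "L2_inner e e \<noteq> 0"
      using insert.prems(3)[OF eS] by auto
    have e_orth: "L2_inner e v = 0" if "v \<in> S'" for v
    proof -
      have "v \<in> L2" using that S'S L2 by blast
      then show ?thesis
        unfolding e_def L2_inner_lincomb_left[OF L2[OF b(1)] L2[OF qS] \<open>v \<in> L2\<close>]
        using q(2)[OF that] by simp
    qed
    define k where "k = F e / L2_inner e e"
    define z' where "z' = (\<lambda>x. 1 * z x + k * e x)"
    have "L2_inner z' v = F v" if v: "v \<in> S" for v
    proof -
      define c where "c = v a / e a"
      define v0 where "v0 = (\<lambda>x. 1 * v x + (-c) * e x)"
      have v0S: "v0 \<in> S" unfolding v0_def by (rule comb[OF v eS])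
      have v0: "v0 \<in> S'"
        using v0S ea by (simp add: S'_def v0_def c_def)
      have v_eq: "v = (\<lambda>x. 1 * v0 x + c * e x)" by (simp add: v0_def)
      have "L2_inner z e = 0" using e_orth[OF z(1)] by (simp add: L2_inner_commute)
      then have zv: "L2_inner z v = F v0"
        by (subst v_eq, subst L2_inner_lincomb_right)
          (use L2 v0S eS zS z(2)[OF v0] in auto)
      have ev: "L2_inner e v = c * L2_inner e e"
        by (subst v_eq, subst L2_inner_lincomb_right)
          (use L2 v0S eS e_orth[OF v0] in auto)
      have "L2_inner z' v = F v0 + k * (c * L2_inner e e)"
        unfolding z'_def by (subst L2_inner_lincomb_left) (use L2 zS eS v zv ev in auto)
      also have "\<dots> = F v0 + c * F e" using ee by (simp add: k_def)
      also have "\<dots> = F v"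
        by (subst v_eq, subst lin) (use v0S eS in auto)
      finally show ?thesis .
    qed
    moreover have "z' \<in> S" unfolding z'_def by (rule comb[OF zS eS])
    ultimately show ?thesis by blast
  qed
qed

section \<open>Finite element functions\<close>

abbreviation cell :: "nat \<Rightarrow> nat \<Rightarrow> real set" where
  "cell M i \<equiv> {real i / real M<..<real (i + 1) / real M}"

lemma fe_space_affine_on_cell:
  assumes "f \<in> fe_space M" "i < M"
  obtains a b where "\<And>x. x \<in> cell M i \<Longrightarrow> f x = a + b * x"
  using assms by (auto simp: fe_space_def)

lemma function_subspace_fe_space: "function_subspace (fe_space M)"
  unfolding function_subspace_def
proof (intro conjI ballI allI)
  have "\<exists>a b :: real. \<forall>x\<in>cell M i. 0 = a + b * x" for i
    by (rule exI[of _ 0], rule exI[of _ 0]) simp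
  then show "(\<lambda>x. 0) \<in> fe_space M"
    by (simp add: fe_space_def)
next
  fix f g and a b :: real
  assume f: "f \<in> fe_space M" and g: "g \<in> fe_space M"
  have "\<exists>c d. \<forall>x\<in>cell M i. a * f x + b * g x = c + d * x" if i: "i < M" for i
  proof -
    obtain c d where cd: "\<And>x. x \<in> cell M i \<Longrightarrow> f x = c + d * x"
      using fe_space_affine_on_cell[OF f i] by blast
    obtain c' d' where cd': "\<And>x. x \<in> cell M i \<Longrightarrow> g x = c' + d' * x"
      using fe_space_affine_on_cell[OF g i] by blast
    have "\<forall>x\<in>cell M i. a * f x + b * g x = (a * c + b * c') + (a * d + b * d') * x"
      using cd cd' by (simp add: algebra_simps)
    then show ?thesis by blast
  qed
  then show "(\<lambda>x. a * f x + b * g x) \<in> fe_space M"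
    using f g unfolding fe_space_def
    by (auto intro!: continuous_on_add continuous_on_mult_left)
qed

lemma fe_space_lincomb:
  "f \<in> fe_space M \<Longrightarrow> g \<in> fe_space M \<Longrightarrow> (\<lambda>x. a * f x + b * g x) \<in> fe_space M"
  using function_subspace_fe_space by (auto simp: function_subspace_def)

lemma continuous_measurable_unit:
  "continuous_on {0..1} f \<Longrightarrow> f \<in> borel_measurable (lebesgue_on {0..1})" for f :: "real \<Rightarrow> real"
  by (rule continuous_imp_measurable_on_sets_lebesgue) auto

lemma fe_space_bounded:
  assumes "f \<in> fe_space M"
  obtains B where "0 \<le> B" "\<And>x. x \<in> {0..1} \<Longrightarrow> \<bar>f x\<bar> \<le> B"
proof -
  have "compact (f ` {0..1})"
    using assms by (intro compact_continuous_image) (auto simp: fe_space_def)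
  then have "bounded (f ` {0..1})" by (rule compact_imp_bounded)
  then obtain B where B: "\<forall>x\<in>{0..1}. \<bar>f x\<bar> \<le> B" by (auto simp: bounded_iff)
  moreover have "0 \<le> B" using B by (auto dest: bspec[of _ _ 0])
  ultimately show ?thesis using that by blast
qed

lemma fe_space_in_L2: "f \<in> fe_space M \<Longrightarrow> f \<in> L2"
  by (metis (no_types, lifting) fe_space_bounded bounded_measurable_in_L2
      continuous_measurable_unit fe_space_def mem_Collect_eq)

lemma fe_space_definite:
  assumes "f \<in> fe_space M" "L2_inner f f = 0"
  shows "f = (\<lambda>x. 0)"
proof -
  have cont: "continuous_on {0..1} (\<lambda>x. f x * f x)"
    using assms(1) by (auto simp: fe_space_def intro!: continuous_on_mult)
  have "integral {0..1} (\<lambda>x. f x * f x) = 0"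
    using assms lebesgue_integral_eq_integral[OF integrable_L2_mult, of f f]
    by (simp add: L2_inner_def fe_space_in_L2)
  then have "\<forall>x\<in>{0..1}. f x * f x = 0"
    by (subst (asm) integral_eq_0_iff[OF cont]) auto
  moreover have "\<forall>x. x \<notin> {0..1} \<longrightarrow> f x = 0"
    using assms(1) by (auto simp: fe_space_def)
  ultimately show ?thesis by (metis mult_eq_0_iff)
qed

lemma unit_interval_cells:
  assumes "0 < M" "x \<in> {0..1}"
  shows "(\<exists>i<M. x \<in> cell M i) \<or> (\<exists>j\<le>M. x = real j / real M)"
proof -
  define i where "i = nat \<lfloor>x * real M\<rfloor>"
  have i: "real i \<le> x * real M" "x * real M < real i + 1"
    using assms by (auto simp: i_def)
  have xM: "x * real M \<le> real M" using assms by (auto simp: mult_left_le_one_le)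
  show ?thesis
  proof (cases "real i = x * real M")
    case True
    with xM have "i \<le> M" by linarith
    moreover have "x = real i / real M" using True \<open>0 < M\<close> by simp
    ultimately show ?thesis by blast
  next
    case False
    with i xM have "i < M" by linarith
    moreover have "x \<in> cell M i"
      using i False assms by (auto simp: field_simps)
    ultimately show ?thesis by blast
  qed
qed

lemma cell_subset_unit:
  assumes "i < M" shows "cell M i \<subseteq> {0..1}"
proof
  fix x assume x: "x \<in> cell M i"
  have "real (i + 1) / real M \<le> 1" using assms by simp
  moreover have "0 \<le> real i / real M" by simp
  ultimately show "x \<in> {0..1}" using x unfolding greaterThanLessThan_iff atLeastAtMost_iff by linarith
qed

text \<open>Every cell contains two of the points \<open>j / (3 M)\<close> in its interior, which fix the affine
  function there, and the nodes are the points with \<open>j\<close> divisible by \<open>3\<close>. The nodes lie in no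
  cell and are listed for their own sake.\<close>

lemma fe_space_determined:
  assumes "0 < M" and f: "f \<in> fe_space M"
    and zero: "\<And>j. j \<le> 3 * M \<Longrightarrow> f (real j / (3 * real M)) = 0"
  shows "f = (\<lambda>x. 0)"
proof
  fix x
  show "f x = 0"
  proof (cases "x \<in> {0..1}")
    case False
    then show ?thesis using f by (auto simp: fe_space_def)
  next
    case True
    from unit_interval_cells[OF \<open>0 < M\<close> True] show ?thesis
    proof (elim disjE exE conjE)
      fix j assume "j \<le> M" and x: "x = real j / real M"
      then have "f (real (3 * j) / (3 * real M)) = 0" by (intro zero) auto
      then show ?thesis by (simp add: x)
    next
      fix i assume "i < M" and x: "x \<in> cell M i"
      then obtain a b where ab: "\<And>y. y \<in> cell M i \<Longrightarrow> f y = a + b * y"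
        using fe_space_affine_on_cell[OF f] by blast
      let ?y1 = "real (3 * i + 1) / (3 * real M)" and ?y2 = "real (3 * i + 2) / (3 * real M)"
      have "?y1 \<in> cell M i" "?y2 \<in> cell M i" using \<open>0 < M\<close> by (auto simp: field_simps)
      moreover have "f ?y1 = 0" "f ?y2 = 0"
        using \<open>i < M\<close> by (intro zero, simp)+
      ultimately have eqs: "a + b * ?y1 = 0" "a + b * ?y2 = 0" using ab by fastforce+
      then have "b * (?y2 - ?y1) = 0" by (simp only: right_diff_distrib)
      moreover have "?y2 - ?y1 \<noteq> 0" using \<open>0 < M\<close> by (simp add: field_simps)
      ultimately have "b = 0" by simp
      with eqs ab x show ?thesis by simp
    qed
  qed
qed

lemma fe_space_riesz:
  assumes "0 < M" "linear_functional_on (fe_space M) F"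
  shows "\<exists>z\<in>fe_space M. \<forall>v\<in>fe_space M. L2_inner z v = F v"
proof (rule riesz_representation)
  show "finite ((\<lambda>j. real j / (3 * real M)) ` {..3 * M})" by simp
  show "function_subspace (fe_space M)" by (rule function_subspace_fe_space)
  show "fe_space M \<subseteq> L2" using fe_space_in_L2 by blast
  show "f = (\<lambda>x. 0)" if "f \<in> fe_space M" "L2_inner f f = 0" for f
    using that by (rule fe_space_definite)
  show "f = (\<lambda>x. 0)" if "f \<in> fe_space M"
    "\<And>x. x \<in> (\<lambda>j. real j / (3 * real M)) ` {..3 * M} \<Longrightarrow> f x = 0" for f
    by (rule fe_space_determined[OF assms(1) that(1)]) (intro that(2) imageI, simp)
qed (rule assms(2))

lemma fe_space_eqI:
  assumes f: "f \<in> fe_space M" and g: "g \<in> fe_space M"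
    and eq: "\<And>v. v \<in> fe_space M \<Longrightarrow> L2_inner f v = L2_inner g v"
  shows "f = g"
proof -
  let ?d = "\<lambda>x. 1 * f x + (-1) * g x"
  have d: "?d \<in> fe_space M" by (rule fe_space_lincomb[OF f g])
  have "L2_inner ?d ?d = 0"
    using eq[OF d] L2_inner_lincomb_left[OF f[THEN fe_space_in_L2] g[THEN fe_space_in_L2]
        d[THEN fe_space_in_L2], of 1 "-1"] by simp
  from fe_space_definite[OF d this] have "?d x = 0" for x by (rule fun_cong)
  then show ?thesis by (auto simp: fun_eq_iff)
qed

lemma L2_proj_fe_space:
  assumes "0 < M" "f \<in> L2"
  shows "L2_proj M f \<in> fe_space M"
    and "\<And>v. v \<in> fe_space M \<Longrightarrow> L2_inner (L2_proj M f) v = L2_inner f v"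
proof -
  have "linear_functional_on (fe_space M) (L2_inner f)"
    using assms(2) fe_space_in_L2
    by (auto simp: linear_functional_on_def intro!: L2_inner_lincomb_right)
  then obtain z where "z \<in> fe_space M \<and> (\<forall>v\<in>fe_space M. L2_inner z v = L2_inner f v)"
    using fe_space_riesz[OF assms(1)] by blast
  then have "\<exists>!p. p \<in> fe_space M \<and> (\<forall>v\<in>fe_space M. L2_inner p v = L2_inner f v)"
    using fe_space_eqI by (metis (no_types, lifting))
  from theI'[OF this] show "L2_proj M f \<in> fe_space M"
    and "\<And>v. v \<in> fe_space M \<Longrightarrow> L2_inner (L2_proj M f) v = L2_inner f v"
    by (auto simp: L2_proj_def)
qed

lemma fe_space_deriv_on_cell:
  assumes "f \<in> fe_space M" "i < M"
  obtains b where "\<And>x. x \<in> cell M i \<Longrightarrow> (f has_field_derivative b) (at x)"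
proof -
  obtain a b where ab: "\<And>x. x \<in> cell M i \<Longrightarrow> f x = a + b * x"
    using fe_space_affine_on_cell[OF assms] by blast
  have "(f has_field_derivative b) (at x)" if "x \<in> cell M i" for x
  proof (rule Deriv.has_field_derivative_transform_within_open[where S = "cell M i"])
    show "((\<lambda>x. a + b * x) has_field_derivative b) (at x)"
      by (auto intro!: derivative_eq_intros)
  qed (use ab that in auto)
  then show ?thesis using that by blast
qed

text \<open>The derivative takes finitely many values on \<open>[0,1]\<close>, one on each cell and one,
  possibly a default value, at each node; so it is bounded and measurable.\<close>

lemma fe_space_deriv_in_L2:
  assumes "0 < M" and f: "f \<in> fe_space M"
  shows "deriv f \<in> L2"
proof -
  have "\<forall>i. \<exists>b. i < M \<longrightarrow> (\<forall>x\<in>cell M i. deriv f x = b)"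
    using fe_space_deriv_on_cell[OF f] DERIV_imp_deriv by metis
  then obtain b where b: "\<And>i x. i < M \<Longrightarrow> x \<in> cell M i \<Longrightarrow> deriv f x = b i" by metis
  define piece where "piece i = (if i < M then cell M i else {real (i - M) / real M} \<inter> {0..1})" for i
  have "deriv f \<in> borel_measurable (lebesgue_on {0..1})"
  proof (rule measurable_piecewise_restrict2)
    show "piece i \<in> sets (lebesgue_on {0..1})" for i
      using cell_subset_unit[of i M] by (auto simp: piece_def sets_restrict_space_iff)
    have "x \<in> (\<Union>i. piece i)" if x: "x \<in> {0..1}" for x
    proof -
      from unit_interval_cells[OF \<open>0 < M\<close> x] show ?thesis
      proof (elim disjE exE conjE)
        fix j assume "x = real j / real M"
        then have "x \<in> piece (M + j)" using x by (simp add: piece_def)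
        then show ?thesis by blast
      qed (auto simp: piece_def)
    qed
    moreover have "piece i \<subseteq> {0..1}" for i
      using cell_subset_unit[of i M] by (auto simp: piece_def)
    ultimately show "space (lebesgue_on {0..1}) = (\<Union>i. piece i)" by auto
    show "\<exists>h\<in>borel_measurable (lebesgue_on {0..1}). \<forall>x\<in>piece i. deriv f x = h x" for i
    proof (intro bexI ballI)
      show "(\<lambda>x. if i < M then b i else deriv f (real (i - M) / real M))
          \<in> borel_measurable (lebesgue_on {0..1})" by simp
      show "deriv f x = (if i < M then b i else deriv f (real (i - M) / real M))"
        if "x \<in> piece i" for x using that b[of i x] by (auto simp: piece_def split: if_splits)
    qed
  qed
  moreover
  define vals where "vals = b ` {..<M} \<union> (\<lambda>j. deriv f (real j / real M)) ` {..M}"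
  have "deriv f x \<in> vals" if "x \<in> {0..1}" for x
    using unit_interval_cells[OF \<open>0 < M\<close> that] b by (auto simp: vals_def)
  then have "\<bar>deriv f x\<bar> \<le> (\<Sum>y\<in>vals. \<bar>y\<bar>)" if "x \<in> {0..1}" for x
    using that by (intro member_le_sum[where f = abs]) (auto simp: vals_def)
  ultimately show ?thesis by (rule bounded_measurable_in_L2)
qed

text \<open>Linearity of \<^const>\<open>deriv\<close> can fail at the nodes, so it holds only after integration.\<close>

lemma L2_inner_deriv_lincomb_left:
  assumes "0 < M" and f: "f \<in> fe_space M" and g: "g \<in> fe_space M" and h: "h \<in> L2"
  shows "L2_inner (deriv (\<lambda>x. a * f x + b * g x)) h
       = a * L2_inner (deriv f) h + b * L2_inner (deriv g) h"
proof -
  note L2 = fe_space_deriv_in_L2[OF \<open>0 < M\<close>]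
  let ?c = "\<lambda>x. a * f x + b * g x" and ?nodes = "(\<lambda>j. real j / real M) ` {..M}"
  have eq: "deriv ?c x = a * deriv f x + b * deriv g x" if x: "x \<in> {0..1} - ?nodes" for x
  proof -
    obtain i where "i < M" "x \<in> cell M i"
      using unit_interval_cells[OF \<open>0 < M\<close>, of x] x by auto
    then have "f field_differentiable (at x)" "g field_differentiable (at x)"
      using fe_space_deriv_on_cell[OF f] fe_space_deriv_on_cell[OF g]
      unfolding field_differentiable_def by metis+
    then show ?thesis
      by (intro DERIV_imp_deriv) (auto intro!: derivative_eq_intros DERIV_deriv_iff_field_differentiable[THEN iffD2])
  qed
  have "AE x in lebesgue. x \<notin> ?nodes"
    by (intro AE_not_in negligible_iff_null_sets[THEN iffD1] negligible_finite) simp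
  then have "AE x in lebesgue_on {0..1}. x \<notin> ?nodes"
    by (subst AE_restrict_space_iff) (simp, rule AE_mp, assumption, simp)
  then have ae: "AE x in lebesgue_on {0..1}. deriv ?c x * h x = (a * deriv f x + b * deriv g x) * h x"
  proof (rule AE_mp, intro AE_I2 impI)
    fix x assume "x \<in> space (lebesgue_on {0..1})" "x \<notin> ?nodes"
    then show "deriv ?c x * h x = (a * deriv f x + b * deriv g x) * h x"
      using eq[of x] by simp
  qed
  have meas: "k \<in> borel_measurable (lebesgue_on {0..1})" if "k \<in> L2" for k
    using that by (simp add: L2_def)
  have "L2_inner (deriv ?c) h = L2_inner (\<lambda>x. a * deriv f x + b * deriv g x) h"
    unfolding L2_inner_def
  proof (rule integral_cong_AE[OF _ _ ae])
    show "(\<lambda>x. deriv ?c x * h x) \<in> borel_measurable (lebesgue_on {0..1})"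
      by (intro borel_measurable_times meas h L2 fe_space_lincomb f g)
    show "(\<lambda>x. (a * deriv f x + b * deriv g x) * h x) \<in> borel_measurable (lebesgue_on {0..1})"
      by (intro borel_measurable_times meas h L2_lincomb L2 f g)
  qed
  then show ?thesis using L2_inner_lincomb_left[OF L2[OF f] L2[OF g] h] by simp
qed


section \<open>The potential\<close>

lemma smooth_imp_DERIV_iterate:
  "smooth V \<Longrightarrow> ((deriv ^^ k) V has_field_derivative (deriv ^^ Suc k) V y) (at y)"
  by (simp add: smooth_def DERIV_deriv_iff_field_differentiable)

text \<open>Two applications of the mean value inequality; this is cruder than Taylor's formula by a
  factor of two.\<close>

lemma linearization_error:
  fixes f f' f'' :: "real \<Rightarrow> real"
  assumes f: "\<And>y. (f has_field_derivative f' y) (at y)"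
    and f': "\<And>y. (f' has_field_derivative f'' y) (at y)"
    and bound: "\<And>y. \<bar>f'' y\<bar> \<le> C"
  shows "\<bar>f (y + h) - f y - f' y * h\<bar> \<le> C * h\<^sup>2"
proof -
  let ?I = "closed_segment y (y + h)"
  have "0 \<le> C" using bound[of 0] by linarith
  define g where "g = (\<lambda>u. f u - f' y * u)"
  have "norm (g (y + h) - g y) \<le> (C * \<bar>h\<bar>) * norm (y + h - y)"
  proof (rule field_differentiable_bound[of ?I g "\<lambda>u. f' u - f' y"])
    show "(g has_field_derivative f' u - f' y) (at u within ?I)" for u
      unfolding g_def
      by (rule has_field_derivative_at_within) (auto intro!: derivative_eq_intros f)
    show "norm (f' u - f' y) \<le> C * \<bar>h\<bar>" if u: "u \<in> ?I" for u
    proof -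
      have "norm (f' u - f' y) \<le> C * norm (u - y)"
        by (rule field_differentiable_bound[of UNIV f' f''])
          (auto intro: has_field_derivative_at_within f' bound)
      also have "\<dots> \<le> C * \<bar>h\<bar>"
        using u \<open>0 \<le> C\<close> by (intro mult_left_mono) (auto simp: closed_segment_eq_real_ivl split: if_splits)
      finally show ?thesis .
    qed
  qed auto
  then show ?thesis by (simp add: g_def algebra_simps power2_eq_square)
qed

lemma modified_double_well_bounds:
  assumes "modified_double_well V s r" "3 \<le> r"
  obtains C where "0 \<le> C" "\<And>y. \<bar>deriv V y\<bar> \<le> C" "\<And>y. \<bar>(deriv ^^ 2) V y\<bar> \<le> C"
    "\<And>y h. \<bar>deriv V (y + h) - deriv V y - (deriv ^^ 2) V y * h\<bar> \<le> C * h\<^sup>2"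
proof -
  have V: "smooth V" using assms(1) by (simp add: modified_double_well_def)
  have "\<exists>C. \<forall>y. \<bar>(deriv ^^ k) V y\<bar> \<le> C" if "k \<in> {1..3}" for k
  proof -
    have "bounded (range ((deriv ^^ k) V))"
      using assms that by (auto simp: modified_double_well_def)
    then show ?thesis by (auto simp: bounded_iff)
  qed
  then obtain B where B: "\<And>k y. k \<in> {1..3} \<Longrightarrow> \<bar>(deriv ^^ k) V y\<bar> \<le> B k" by metis
  let ?C = "max (B 1) (max (B 2) (B 3))"
  have D: "((deriv ^^ k) V has_field_derivative (deriv ^^ Suc k) V y) (at y)" for k y
    by (rule smooth_imp_DERIV_iterate[OF V])
  show ?thesis
  proof (rule that)
    show "0 \<le> ?C" using B[of 1 0] by auto
    show "\<bar>deriv V y\<bar> \<le> ?C" for y using B[of 1 y] by auto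
    show "\<bar>(deriv ^^ 2) V y\<bar> \<le> ?C" for y using B[of 2 y] by auto
    have "\<bar>deriv V (y + h) - deriv V y - (deriv ^^ 2) V y * h\<bar> \<le> B 3 * h\<^sup>2" for y h
      using D[of 1] D[of 2] B[of 3]
      by (intro linearization_error) (auto simp: numeral_eq_Suc)
    moreover have "B 3 * h\<^sup>2 \<le> ?C * h\<^sup>2" for h by (intro mult_right_mono) auto
    ultimately show "\<bar>deriv V (y + h) - deriv V y - (deriv ^^ 2) V y * h\<bar> \<le> ?C * h\<^sup>2" for y h
      by (meson order_trans)
  qed
qed

section \<open>Perturbing a trajectory at one time\<close>

text \<open>The form in which optimality is used: a one-parameter family whose cost exceeds the optimal
  one by at most \<open>\<epsilon> L + B \<epsilon>\<^sup>2\<close> forces \<open>L = 0\<close>, so the cost itself never has to be differentiated.\<close>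

lemma stationary_if_quadratic_lower_bound:
  fixes L B :: real
  assumes "0 \<le> B" and nonneg: "\<And>\<epsilon>. \<bar>\<epsilon>\<bar> \<le> 1 \<Longrightarrow> 0 \<le> \<epsilon> * L + B * \<epsilon>\<^sup>2"
  shows "L = 0"
proof (rule ccontr)
  assume "L \<noteq> 0"
  define m where "m = B + \<bar>L\<bar> + 1"
  have m: "0 < m" "B < m" using \<open>0 \<le> B\<close> by (auto simp: m_def)
  have "\<bar>- L / m\<bar> \<le> 1" using m \<open>0 \<le> B\<close> by (simp add: abs_divide m_def)
  from nonneg[OF this] have "0 \<le> (B - m) * (L / m)\<^sup>2"
    using m by (simp add: power2_eq_square field_simps)
  moreover have "0 < (L / m)\<^sup>2" using \<open>L \<noteq> 0\<close> m by simp
  ultimately show False using m by (simp add: zero_le_mult_iff)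
qed

lemma sum_fun_upd_atLeastLessThan:
  fixes f :: "'a \<Rightarrow> real" and k N :: nat
  assumes "k < N"
  shows "(\<Sum>n=0..<N. f ((g(k := a)) n)) = (\<Sum>n=0..<N. f (g n)) + (f a - f (g k))"
proof -
  have split: "(\<Sum>n=0..<N. h n) = h k + (\<Sum>n\<in>{0..<N} - {k}. h n)" for h :: "nat \<Rightarrow> real"
    using assms by (intro sum.remove) auto
  have "(\<Sum>n\<in>{0..<N} - {k}. f ((g(k := a)) n)) = (\<Sum>n\<in>{0..<N} - {k}. f (g n))"
    by (rule sum.cong) auto
  then show ?thesis
    unfolding split[of "\<lambda>n. f ((g(k := a)) n)"] split[of "\<lambda>n. f (g n)"] by simp
qed

lemma running_cost_add:
  assumes "f \<in> L2" "g \<in> L2"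
  shows "running_cost (\<lambda>x. f x + c * g x)
       = running_cost f + c * L2_inner f g + c\<^sup>2 / 2 * L2_inner g g"
  using L2_inner_self_add[OF assms, of c] by (simp add: running_cost_def L2_norm_power2 field_simps)

locale discrete_control =
  fixes \<delta> T K s :: real and r M N :: nat and V \<phi>m :: "real \<Rightarrow> real"
  assumes \<delta>_pos: "\<delta> > 0" and T_pos: "T > 0"
    and r_ge: "r \<ge> 3" and V: "modified_double_well V s r"
    and \<phi>m_L2: "\<phi>m \<in> L2" and M_pos: "M > 0" and N_pos: "N > 0"
begin

definition dt :: real where "dt = T / real N"

lemma dt_pos: "0 < dt"
  using T_pos N_pos by (simp add: dt_def)

lemma fe_compose_in_L2:
  assumes "continuous_on UNIV W" "\<And>y. \<bar>W y\<bar> \<le> C" "f \<in> fe_space M"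
  shows "(\<lambda>x. W (f x)) \<in> L2"
proof (rule bounded_measurable_in_L2)
  have "continuous_on {0..1} (\<lambda>x. W (f x))"
    by (rule continuous_on_compose2[OF assms(1)]) (use assms(3) in \<open>auto simp: fe_space_def\<close>)
  then show "(\<lambda>x. W (f x)) \<in> borel_measurable (lebesgue_on {0..1})"
    by (rule continuous_measurable_unit)
qed (rule assms(2))

lemma continuous_deriv_V: "continuous_on UNIV ((deriv ^^ k) V)"
  using V smooth_imp_DERIV_iterate[of V k]
  by (intro continuous_at_imp_continuous_on) (auto simp: modified_double_well_def intro: DERIV_isCont)

lemma deriv_V_fe_in_L2: "f \<in> fe_space M \<Longrightarrow> (\<lambda>x. deriv V (f x)) \<in> L2"
  using modified_double_well_bounds[OF V r_ge] continuous_deriv_V[of 1] fe_compose_in_L2[of "deriv V"]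
  by (metis One_nat_def funpow_0 funpow.simps(2) o_apply)

lemma deriv2_V_mult_fe_in_L2:
  assumes "f \<in> fe_space M" "w \<in> fe_space M"
  shows "(\<lambda>x. (deriv ^^ 2) V (f x) * w x) \<in> L2"
proof -
  obtain C where C: "0 \<le> C" "\<And>y. \<bar>(deriv ^^ 2) V y\<bar> \<le> C"
    using modified_double_well_bounds[OF V r_ge] by metis
  obtain W where W: "0 \<le> W" "\<And>x. x \<in> {0..1} \<Longrightarrow> \<bar>w x\<bar> \<le> W"
    using fe_space_bounded[OF assms(2)] by blast
  show ?thesis
  proof (rule bounded_measurable_in_L2)
    show "(\<lambda>x. (deriv ^^ 2) V (f x) * w x) \<in> borel_measurable (lebesgue_on {0..1})"
      using fe_compose_in_L2[OF continuous_deriv_V C(2) assms(1)] fe_space_in_L2[OF assms(2)]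
      by (auto simp: L2_def intro!: borel_measurable_times)
    show "\<bar>(deriv ^^ 2) V (f x) * w x\<bar> \<le> C * W" if "x \<in> {0..1}" for x
      unfolding abs_mult using C W that by (intro mult_mono) auto
  qed
qed

lemma L2_inner_drift:
  assumes "f \<in> fe_space M" "a \<in> fe_space M" "v \<in> fe_space M"
  shows "L2_inner (\<lambda>x. - (1/\<delta>) * deriv V (f x) + a x) v
       = - (1/\<delta>) * L2_inner (\<lambda>x. deriv V (f x)) v + L2_inner a v"
  using L2_inner_lincomb_left[OF deriv_V_fe_in_L2[OF assms(1)] fe_space_in_L2[OF assms(2)]
      fe_space_in_L2[OF assms(3)], of "- (1/\<delta>)" 1] by simp

lemma linear_stiffness:
  assumes "w \<in> fe_space M" "f \<in> fe_space M" "g \<in> fe_space M"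
  shows "L2_inner (deriv w) (deriv (\<lambda>x. a * f x + b * g x))
       = a * L2_inner (deriv w) (deriv f) + b * L2_inner (deriv w) (deriv g)"
  using L2_inner_deriv_lincomb_left[OF M_pos assms(2,3) fe_space_deriv_in_L2[OF M_pos assms(1)]]
  by (simp add: L2_inner_commute)

text \<open>The right-hand side is the general shape of one step of the adjoint scheme, tested with \<open>v\<close>;
  it serves both to linearize the perturbed control and to construct the dual variable at time \<open>0\<close>.\<close>

lemma linearized_step_riesz:
  assumes f: "f \<in> fe_space M" and w: "w \<in> fe_space M"
  obtains z where "z \<in> fe_space M" "\<And>v. v \<in> fe_space M \<Longrightarrow> L2_inner z v =
    a * L2_inner w v + b * L2_inner (deriv w) (deriv v)
      + c * L2_inner (\<lambda>x. (deriv ^^ 2) V (f x) * w x) v"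
proof -
  let ?F = "\<lambda>v. a * L2_inner w v + b * L2_inner (deriv w) (deriv v)
      + c * L2_inner (\<lambda>x. (deriv ^^ 2) V (f x) * w x) v"
  have "linear_functional_on (fe_space M) ?F"
    unfolding linear_functional_on_def
  proof (intro ballI allI)
    fix g h a' b' assume g: "g \<in> fe_space M" and h: "h \<in> fe_space M"
    show "?F (\<lambda>x. a' * g x + b' * h x) = a' * ?F g + b' * ?F h"
      unfolding linear_stiffness[OF w g h]
        L2_inner_lincomb_right[OF g[THEN fe_space_in_L2] h[THEN fe_space_in_L2] w[THEN fe_space_in_L2]]
        L2_inner_lincomb_right[OF g[THEN fe_space_in_L2] h[THEN fe_space_in_L2]
          deriv2_V_mult_fe_in_L2[OF f w]]
      by (simp add: algebra_simps)
  qed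
  from fe_space_riesz[OF M_pos this] show ?thesis using that by blast
qed

text \<open>If the state \<open>f\<close> at an interior time is moved to \<open>f + \<epsilon> w\<close>, the control \<open>a\<close> applied at that
  time must be changed by \<open>z\<close> for the next state to stay where it is. The scheme is explicit, so
  \<open>z\<close> is given by a formula that is nonlinear only through \<open>V'\<close>. Splitting off the linear part
  leaves the projection of a multiple of the Taylor remainder of \<open>V'\<close>, which is \<open>O(\<epsilon>\<^sup>2)\<close> because the third derivative
  of \<open>V\<close> is bounded; this gives the derivative of \<open>(a, z)\<close> and shows that \<open>(z, z)\<close> is of second order.\<close>

lemma compensating_control:
  assumes f: "f \<in> fe_space M" and w: "w \<in> fe_space M" and a: "a \<in> fe_space M"
  obtains B where "0 \<le> B"
    and "\<And>\<epsilon>. \<bar>\<epsilon>\<bar> \<le> 1 \<Longrightarrow> \<exists>z\<in>fe_space M.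
      (\<forall>v\<in>fe_space M. L2_inner z v = - (\<epsilon> / dt) * L2_inner w v
          + \<delta> * \<epsilon> * L2_inner (deriv w) (deriv v)
          + 1/\<delta> * (L2_inner (\<lambda>x. deriv V (f x + \<epsilon> * w x)) v - L2_inner (\<lambda>x. deriv V (f x)) v)) \<and>
      \<bar>L2_inner a z - \<epsilon> * (- (1 / dt) * L2_inner w a + \<delta> * L2_inner (deriv w) (deriv a)
          + 1/\<delta> * L2_inner (\<lambda>x. (deriv ^^ 2) V (f x) * w x) a)\<bar> \<le> B * \<epsilon>\<^sup>2 \<and>
      L2_inner z z \<le> B * \<epsilon>\<^sup>2"
proof -
  obtain C where C: "0 \<le> C" "\<And>y. \<bar>(deriv ^^ 2) V y\<bar> \<le> C"
    "\<And>y h. \<bar>deriv V (y + h) - deriv V y - (deriv ^^ 2) V y * h\<bar> \<le> C * h\<^sup>2"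
    using modified_double_well_bounds[OF V r_ge] by metis
  obtain W where W: "0 \<le> W" "\<And>x. x \<in> {0..1} \<Longrightarrow> \<bar>w x\<bar> \<le> W"
    using fe_space_bounded[OF w] by blast
  obtain A where A: "0 \<le> A" "\<And>x. x \<in> {0..1} \<Longrightarrow> \<bar>a x\<bar> \<le> A"
    using fe_space_bounded[OF a] by blast
  obtain z1 where z1: "z1 \<in> fe_space M" "\<And>v. v \<in> fe_space M \<Longrightarrow> L2_inner z1 v =
      - (1 / dt) * L2_inner w v + \<delta> * L2_inner (deriv w) (deriv v)
      + 1/\<delta> * L2_inner (\<lambda>x. (deriv ^^ 2) V (f x) * w x) v"
    using linearized_step_riesz[OF f w] by blast
  obtain Z where Z: "0 \<le> Z" "\<And>x. x \<in> {0..1} \<Longrightarrow> \<bar>z1 x\<bar> \<le> Z"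
    using fe_space_bounded[OF z1(1)] by blast
  define E where "E = C * W\<^sup>2 / \<delta>"
  have "0 \<le> E" using C \<delta>_pos by (simp add: E_def)
  define B where "B = E\<^sup>2 + 2 * (E * Z) + L2_inner z1 z1 + E * A"
  show ?thesis
  proof (rule that[of B])
    show "0 \<le> B" using \<open>0 \<le> E\<close> Z A L2_inner_self_nonneg[of z1] by (simp add: B_def)
    fix \<epsilon> :: real assume \<epsilon>: "\<bar>\<epsilon>\<bar> \<le> 1"
    have f\<epsilon>: "(\<lambda>x. f x + \<epsilon> * w x) \<in> fe_space M"
      using fe_space_lincomb[OF f w, of 1 \<epsilon>] by simp
    note L2s = deriv_V_fe_in_L2[OF f\<epsilon>] deriv_V_fe_in_L2[OF f] deriv2_V_mult_fe_in_L2[OF f w]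
    define D where "D = (\<lambda>x. 1 * deriv V (f x + \<epsilon> * w x) + (-1) * deriv V (f x))"
    define R where "R = (\<lambda>x. (1/\<delta>) * D x + (- (\<epsilon>/\<delta>)) * ((deriv ^^ 2) V (f x) * w x))"
    have D: "D \<in> L2" unfolding D_def by (rule L2_lincomb[OF L2s(1,2)])
    have R: "R \<in> L2" unfolding R_def by (rule L2_lincomb[OF D L2s(3)])
    have R_inner: "L2_inner R v = 1/\<delta> * (L2_inner (\<lambda>x. deriv V (f x + \<epsilon> * w x)) v
        - L2_inner (\<lambda>x. deriv V (f x)) v) - \<epsilon>/\<delta> * L2_inner (\<lambda>x. (deriv ^^ 2) V (f x) * w x) v"
      if "v \<in> L2" for v
      unfolding R_def L2_inner_lincomb_left[OF D L2s(3) that]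
      unfolding D_def L2_inner_lincomb_left[OF L2s(1,2) that] by simp
    have R_bound: "\<bar>R x\<bar> \<le> E * \<epsilon>\<^sup>2" if x: "x \<in> {0..1}" for x
    proof -
      have "R x = (1/\<delta>) * (deriv V (f x + \<epsilon> * w x) - deriv V (f x)
                  - (deriv ^^ 2) V (f x) * (\<epsilon> * w x))"
        by (simp add: R_def D_def algebra_simps)
      then have "\<bar>R x\<bar> = (1/\<delta>) * \<bar>deriv V (f x + \<epsilon> * w x) - deriv V (f x)
                  - (deriv ^^ 2) V (f x) * (\<epsilon> * w x)\<bar>"
        using \<delta>_pos by (simp only: abs_mult) simp
      also have "\<dots> \<le> (1/\<delta>) * (C * (\<epsilon> * w x)\<^sup>2)"
        using \<delta>_pos by (intro mult_left_mono C) simp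
      also have "\<dots> = C / \<delta> * \<epsilon>\<^sup>2 * (w x)\<^sup>2" by (simp add: power_mult_distrib)
      also have "\<dots> \<le> C / \<delta> * \<epsilon>\<^sup>2 * W\<^sup>2"
        using C \<delta>_pos power_mono[OF W(2)[OF x], of 2] by (intro mult_left_mono) auto
      finally show ?thesis by (simp add: E_def mult.commute mult.left_commute)
    qed
    have E\<epsilon>: "0 \<le> E * \<epsilon>\<^sup>2" using \<open>0 \<le> E\<close> by simp
    have "linear_functional_on (fe_space M) (L2_inner R)"
      using R fe_space_in_L2
      by (auto simp: linear_functional_on_def intro!: L2_inner_lincomb_right)
    then obtain \<zeta> where \<zeta>: "\<zeta> \<in> fe_space M" "\<And>v. v \<in> fe_space M \<Longrightarrow> L2_inner \<zeta> v = L2_inner R v"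
      using fe_space_riesz[OF M_pos] by blast
    note L2 = fe_space_in_L2[OF \<zeta>(1)] fe_space_in_L2[OF z1(1)]
    define z where "z = (\<lambda>x. \<zeta> x + \<epsilon> * z1 x)"
    have z: "z \<in> fe_space M" using fe_space_lincomb[OF \<zeta>(1) z1(1), of 1 \<epsilon>] by (simp add: z_def)
    have z_inner: "L2_inner z v = L2_inner R v + \<epsilon> * L2_inner z1 v" if "v \<in> fe_space M" for v
      using L2_inner_lincomb_left[OF L2 fe_space_in_L2[OF that], of 1 \<epsilon>] \<zeta>(2)[OF that]
      by (simp add: z_def)
    have eq: "L2_inner z v = - (\<epsilon> / dt) * L2_inner w v
          + \<delta> * \<epsilon> * L2_inner (deriv w) (deriv v)
          + 1/\<delta> * (L2_inner (\<lambda>x. deriv V (f x + \<epsilon> * w x)) v - L2_inner (\<lambda>x. deriv V (f x)) v)"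
      if v: "v \<in> fe_space M" for v
      unfolding z_inner[OF v] z1(2)[OF v] R_inner[OF fe_space_in_L2[OF v]]
      by (simp add: algebra_simps)
    have "\<bar>L2_inner R a\<bar> \<le> (E * \<epsilon>\<^sup>2) * A"
      by (rule L2_inner_bound[OF R fe_space_in_L2[OF a] E\<epsilon> R_bound A(2)])
    moreover have "(E * \<epsilon>\<^sup>2) * A \<le> B * \<epsilon>\<^sup>2"
    proof -
      have "E * A \<le> B" using \<open>0 \<le> E\<close> Z L2_inner_self_nonneg[of z1] by (simp add: B_def)
      then have "E * A * \<epsilon>\<^sup>2 \<le> B * \<epsilon>\<^sup>2" by (rule mult_right_mono) simp
      then show ?thesis by (simp add: mult.commute mult.left_commute)
    qed
    moreover have "L2_inner a z - \<epsilon> * L2_inner z1 a = L2_inner R a"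
      using z_inner[OF a] by (simp add: L2_inner_commute)
    ultimately have lin: "\<bar>L2_inner a z - \<epsilon> * L2_inner z1 a\<bar> \<le> B * \<epsilon>\<^sup>2" by linarith
    \<comment> \<open>\<open>\<zeta>\<close> is the projection of \<open>R\<close>, hence not longer than \<open>R\<close>.\<close>
    have "0 \<le> L2_inner (\<lambda>x. R x + (-1) * \<zeta> x) (\<lambda>x. R x + (-1) * \<zeta> x)"
      by (rule L2_inner_self_nonneg)
    then have "L2_inner \<zeta> \<zeta> \<le> L2_inner R R"
      unfolding L2_inner_self_add[OF R L2(1)] using \<zeta>(2)[OF \<zeta>(1)] by simp
    also have "\<dots> \<le> (E * \<epsilon>\<^sup>2) * (E * \<epsilon>\<^sup>2)"
      using L2_inner_bound[OF R R E\<epsilon> R_bound R_bound] by simp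
    also have "\<dots> \<le> E\<^sup>2 * \<epsilon>\<^sup>2"
    proof -
      have "\<epsilon>\<^sup>2 * \<epsilon>\<^sup>2 \<le> 1 * \<epsilon>\<^sup>2"
        using \<epsilon> by (intro mult_right_mono) (auto simp: abs_square_le_1)
      then have "E\<^sup>2 * (\<epsilon>\<^sup>2 * \<epsilon>\<^sup>2) \<le> E\<^sup>2 * \<epsilon>\<^sup>2" by (intro mult_left_mono) auto
      then show ?thesis by (simp add: power2_eq_square mult.commute mult.left_commute)
    qed
    finally have \<zeta>\<zeta>: "L2_inner \<zeta> \<zeta> \<le> E\<^sup>2 * \<epsilon>\<^sup>2" .
    have "\<bar>L2_inner R z1\<bar> \<le> (E * \<epsilon>\<^sup>2) * Z"
      by (rule L2_inner_bound[OF R L2(2) E\<epsilon> R_bound Z(2)])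
    then have "\<bar>\<epsilon> * L2_inner R z1\<bar> \<le> 1 * ((E * \<epsilon>\<^sup>2) * Z)"
      unfolding abs_mult using \<epsilon> by (intro mult_mono) auto
    then have "2 * \<epsilon> * L2_inner R z1 \<le> 2 * (E * Z) * \<epsilon>\<^sup>2"
      by (simp add: mult.commute mult.left_commute)
    moreover have "L2_inner z z = L2_inner \<zeta> \<zeta> + 2 * \<epsilon> * L2_inner R z1 + \<epsilon>\<^sup>2 * L2_inner z1 z1"
      unfolding z_def L2_inner_self_add[OF L2] \<zeta>(2)[OF z1(1)] by simp
    ultimately have "L2_inner z z \<le> E\<^sup>2 * \<epsilon>\<^sup>2 + 2 * (E * Z) * \<epsilon>\<^sup>2 + \<epsilon>\<^sup>2 * L2_inner z1 z1"
      using \<zeta>\<zeta> by linarith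
    also have "\<dots> \<le> B * \<epsilon>\<^sup>2"
    proof -
      have "0 \<le> E * A * \<epsilon>\<^sup>2" using \<open>0 \<le> E\<close> A by simp
      then show ?thesis by (simp add: B_def algebra_simps)
    qed
    finally have quad: "L2_inner z z \<le> B * \<epsilon>\<^sup>2" .
    show "\<exists>z\<in>fe_space M.
      (\<forall>v\<in>fe_space M. L2_inner z v = - (\<epsilon> / dt) * L2_inner w v
          + \<delta> * \<epsilon> * L2_inner (deriv w) (deriv v)
          + 1/\<delta> * (L2_inner (\<lambda>x. deriv V (f x + \<epsilon> * w x)) v - L2_inner (\<lambda>x. deriv V (f x)) v)) \<and>
      \<bar>L2_inner a z - \<epsilon> * (- (1 / dt) * L2_inner w a + \<delta> * L2_inner (deriv w) (deriv a)
          + 1/\<delta> * L2_inner (\<lambda>x. (deriv ^^ 2) V (f x) * w x) a)\<bar> \<le> B * \<epsilon>\<^sup>2 \<and>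
      L2_inner z z \<le> B * \<epsilon>\<^sup>2"
      using z eq lin quad unfolding z1(2)[OF a] by blast
  qed
qed


section \<open>First-order conditions for a minimizer\<close>

lemma discrete_cost_dt:
  "discrete_cost T K \<phi>m N 0 \<alpha> \<phi>
     = terminal_cost K \<phi>m (\<phi> N) + dt * (\<Sum>n=0..<N. running_cost (\<alpha> n))"
  by (simp add: discrete_cost_def dt_def)

text \<open>Moving only the state at time \<open>j + 1\<close> disturbs the two steps that touch it. The step into it is
  repaired by adding \<open>\<epsilon> w / \<Delta>t\<close> to the control at time \<open>j\<close>, the step out of it by \<open>z\<close>. For \<open>j + 1 = N\<close>
  there is no step out, and the index \<open>N\<close> lies beyond the
  range of the controls.\<close>

lemma perturbed_admissible:
  assumes adm: "admissible \<delta> T V M N 0 \<phi>0 \<alpha> \<phi>" and "j < N"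
    and w: "w \<in> fe_space M" and z: "z \<in> fe_space M"
    and z_inner: "\<And>v. Suc j < N \<Longrightarrow> v \<in> fe_space M \<Longrightarrow>
      L2_inner z v = - (\<epsilon> / dt) * L2_inner w v + \<delta> * \<epsilon> * L2_inner (deriv w) (deriv v)
        + 1/\<delta> * (L2_inner (\<lambda>x. deriv V (\<phi> (Suc j) x + \<epsilon> * w x)) v
                 - L2_inner (\<lambda>x. deriv V (\<phi> (Suc j) x)) v)"
  shows "admissible \<delta> T V M N 0 \<phi>0
    (\<alpha>(j := \<lambda>x. \<alpha> j x + \<epsilon> / dt * w x, Suc j := \<lambda>x. \<alpha> (Suc j) x + 1 * z x))
    (\<phi>(Suc j := \<lambda>x. \<phi> (Suc j) x + \<epsilon> * w x))"
    (is "admissible \<delta> T V M N 0 \<phi>0 ?\<alpha> ?\<phi>")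
proof -
  have \<alpha>: "\<And>n. n < N \<Longrightarrow> \<alpha> n \<in> fe_space M" and \<phi>: "\<And>n. n \<le> N \<Longrightarrow> \<phi> n \<in> fe_space M"
    and init: "\<phi> 0 = \<phi>0"
    and step: "\<And>n v. n < N \<Longrightarrow> v \<in> fe_space M \<Longrightarrow> L2_inner (\<phi> (n+1)) v = L2_inner (\<phi> n) v
          + dt * (- \<delta> * L2_inner (deriv (\<phi> n)) (deriv v)
               + L2_inner (\<lambda>x. - (1/\<delta>) * deriv V (\<phi> n x) + \<alpha> n x) v)"
    using adm by (auto simp: admissible_def discrete_state_def dt_def)
  note lc = fe_space_lincomb[of _ M _ 1, simplified]
  have \<alpha>': "?\<alpha> n \<in> fe_space M" if "n < N" for n
    using lc[OF \<alpha> w, of j "\<epsilon> / dt"] lc[OF \<alpha> z, of "Suc j" 1] that \<open>j < N\<close> \<alpha> by auto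
  have \<phi>': "?\<phi> n \<in> fe_space M" if "n \<le> N" for n
    using lc[OF \<phi> w] that \<open>j < N\<close> \<phi> by auto
  have add: "L2_inner (\<lambda>x. f x + c * g x) v = L2_inner f v + c * L2_inner g v"
    if "f \<in> fe_space M" "g \<in> fe_space M" "v \<in> fe_space M" for f g v c
    using L2_inner_lincomb_left[of f g v 1 c] that fe_space_in_L2 by simp
  have "L2_inner (?\<phi> (n+1)) v = L2_inner (?\<phi> n) v
          + dt * (- \<delta> * L2_inner (deriv (?\<phi> n)) (deriv v)
               + L2_inner (\<lambda>x. - (1/\<delta>) * deriv V (?\<phi> n x) + ?\<alpha> n x) v)"
    if n: "n < N" and v: "v \<in> fe_space M" for n v
  proof -
    note drift' = L2_inner_drift[OF \<phi>'[OF less_imp_le[OF n]] \<alpha>'[OF n] v]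
    note step' = step[OF n v, unfolded L2_inner_drift[OF \<phi>[OF less_imp_le[OF n]] \<alpha>[OF n] v]]
    consider "n = j" | "n = Suc j" | "n \<noteq> j" "n \<noteq> Suc j" by blast
    then show ?thesis
    proof cases
      case 1
      have "L2_inner (?\<phi> (n+1)) v = L2_inner (\<phi> (n+1)) v + \<epsilon> * L2_inner w v"
        using 1 add[OF \<phi> w v, of "Suc j" \<epsilon>] \<open>j < N\<close> by simp
      moreover have "L2_inner (?\<alpha> n) v = L2_inner (\<alpha> n) v + \<epsilon> / dt * L2_inner w v"
        using 1 add[OF \<alpha> w v, of j "\<epsilon> / dt"] \<open>j < N\<close> by simp
      moreover have "dt * (\<epsilon> / dt * L2_inner w v) = \<epsilon> * L2_inner w v"
        using dt_pos by simp
      moreover have "?\<phi> n = \<phi> n" using 1 by simp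
      ultimately show ?thesis
        unfolding drift' step' by (simp only: distrib_left)
    next
      case 2
      then have k: "Suc j < N" "Suc j \<le> N" using n by auto
      have "?\<phi> (n+1) = \<phi> (n+1)" using 2 by simp
      moreover have "L2_inner (?\<phi> n) v = L2_inner (\<phi> n) v + \<epsilon> * L2_inner w v"
        using 2 add[OF \<phi>[OF k(2)] w v, of \<epsilon>] by simp
      moreover have "L2_inner (deriv (?\<phi> n)) (deriv v)
          = L2_inner (deriv (\<phi> n)) (deriv v) + \<epsilon> * L2_inner (deriv w) (deriv v)"
        using 2 L2_inner_deriv_lincomb_left[OF M_pos \<phi>[OF k(2)] w fe_space_deriv_in_L2[OF M_pos v], of 1 \<epsilon>]
        by simp
      moreover have "L2_inner (?\<alpha> n) v = L2_inner (\<alpha> n) v + L2_inner z v"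
        using 2 add[OF \<alpha>[OF k(1)] z v, of 1] by simp
      moreover have "(\<lambda>x. deriv V (?\<phi> n x)) = (\<lambda>x. deriv V (\<phi> n x + \<epsilon> * w x))"
        using 2 by simp
      moreover note z_inner[OF k(1) v, folded 2]
      moreover have "dt * (\<epsilon> / dt * L2_inner w v) = \<epsilon> * L2_inner w v"
        using dt_pos by simp
      ultimately show ?thesis
        unfolding drift' using step' by (simp only:) (simp add: algebra_simps)
    next
      case 3
      then show ?thesis using step[OF n v] by simp
    qed
  qed
  moreover have "?\<phi> 0 = \<phi>0" using init by simp
  ultimately show ?thesis
    using \<alpha>' \<phi>' unfolding admissible_def discrete_state_def dt_def[symmetric]
    by (simp del: fun_upd_apply)
qed

context
  fixes \<phi>0 :: "real \<Rightarrow> real" and \<alpha> \<phi> :: "nat \<Rightarrow> real \<Rightarrow> real"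
  assumes adm: "admissible \<delta> T V M N 0 \<phi>0 \<alpha> \<phi>"
    and minimal: "\<And>\<alpha>' \<phi>'. admissible \<delta> T V M N 0 \<phi>0 \<alpha>' \<phi>' \<Longrightarrow>
      discrete_cost T K \<phi>m N 0 \<alpha> \<phi> \<le> discrete_cost T K \<phi>m N 0 \<alpha>' \<phi>'"
begin

lemma control_fe: "n < N \<Longrightarrow> \<alpha> n \<in> fe_space M"
  using adm by (simp add: admissible_def)

lemma state_fe: "n \<le> N \<Longrightarrow> \<phi> n \<in> fe_space M"
  using adm by (simp add: admissible_def discrete_state_def)

text \<open>The states at all other times, and hence the terminal cost, are unchanged by the perturbation;
  the two terms that change in the running cost already give the adjoint equation for \<open>- \<alpha>\<close>.\<close>

lemma stationarity_interior:
  assumes j: "Suc j < N" and w: "w \<in> fe_space M"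
  shows "L2_inner (\<alpha> j) w = L2_inner (\<alpha> (Suc j)) w
    - dt * (\<delta> * L2_inner (deriv w) (deriv (\<alpha> (Suc j)))
            + 1/\<delta> * L2_inner (\<lambda>x. (deriv ^^ 2) V (\<phi> (Suc j) x) * w x) (\<alpha> (Suc j)))"
proof -
  let ?k = "Suc j"
  have \<alpha>: "\<alpha> j \<in> fe_space M" "\<alpha> ?k \<in> fe_space M" and \<phi>: "\<phi> ?k \<in> fe_space M"
    using control_fe state_fe j by auto
  define L where "L = - (1 / dt) * L2_inner w (\<alpha> ?k) + \<delta> * L2_inner (deriv w) (deriv (\<alpha> ?k))
          + 1/\<delta> * L2_inner (\<lambda>x. (deriv ^^ 2) V (\<phi> ?k x) * w x) (\<alpha> ?k)"
  obtain B where B: "0 \<le> B" and ex: "\<And>\<epsilon>. \<bar>\<epsilon>\<bar> \<le> 1 \<Longrightarrow> \<exists>z\<in>fe_space M.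
      (\<forall>v\<in>fe_space M. L2_inner z v = - (\<epsilon> / dt) * L2_inner w v
          + \<delta> * \<epsilon> * L2_inner (deriv w) (deriv v)
          + 1/\<delta> * (L2_inner (\<lambda>x. deriv V (\<phi> ?k x + \<epsilon> * w x)) v
                   - L2_inner (\<lambda>x. deriv V (\<phi> ?k x)) v)) \<and>
      \<bar>L2_inner (\<alpha> ?k) z - \<epsilon> * L\<bar> \<le> B * \<epsilon>\<^sup>2 \<and> L2_inner z z \<le> B * \<epsilon>\<^sup>2"
    unfolding L_def using compensating_control[OF \<phi> w \<alpha>(2)] by blast
  define Q where "Q = (1 / dt)\<^sup>2 / 2 * L2_inner w w + 3/2 * B"
  have "L2_inner (\<alpha> j) w / dt + L = 0"
  proof (rule stationary_if_quadratic_lower_bound)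
    show "0 \<le> Q" using B L2_inner_self_nonneg[of w] by (simp add: Q_def)
    fix \<epsilon> :: real assume "\<bar>\<epsilon>\<bar> \<le> 1"
    then obtain z where z: "z \<in> fe_space M"
      "\<And>v. v \<in> fe_space M \<Longrightarrow> L2_inner z v = - (\<epsilon> / dt) * L2_inner w v
          + \<delta> * \<epsilon> * L2_inner (deriv w) (deriv v)
          + 1/\<delta> * (L2_inner (\<lambda>x. deriv V (\<phi> ?k x + \<epsilon> * w x)) v
                   - L2_inner (\<lambda>x. deriv V (\<phi> ?k x)) v)"
      and z_bounds: "\<bar>L2_inner (\<alpha> ?k) z - \<epsilon> * L\<bar> \<le> B * \<epsilon>\<^sup>2" "L2_inner z z \<le> B * \<epsilon>\<^sup>2"
      using ex by blast
    let ?a1 = "\<lambda>x. \<alpha> j x + \<epsilon> / dt * w x" and ?a2 = "\<lambda>x. \<alpha> ?k x + 1 * z x"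
    let ?\<alpha> = "\<alpha>(j := ?a1, ?k := ?a2)" and ?\<phi> = "\<phi>(?k := \<lambda>x. \<phi> ?k x + \<epsilon> * w x)"
    have "j < N" using j by simp
    have "admissible \<delta> T V M N 0 \<phi>0 ?\<alpha> ?\<phi>"
      by (rule perturbed_admissible[OF adm \<open>j < N\<close> w z(1)]) (rule z(2))
    then have "discrete_cost T K \<phi>m N 0 \<alpha> \<phi> \<le> discrete_cost T K \<phi>m N 0 ?\<alpha> ?\<phi>"
      by (rule minimal)
    moreover have "?\<phi> N = \<phi> N" using j by simp
    moreover have "(\<Sum>n=0..<N. running_cost (?\<alpha> n)) = (\<Sum>n=0..<N. running_cost (\<alpha> n))
        + (running_cost ?a1 - running_cost (\<alpha> j)) + (running_cost ?a2 - running_cost (\<alpha> ?k))"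
      unfolding sum_fun_upd_atLeastLessThan[OF j] sum_fun_upd_atLeastLessThan[OF \<open>j < N\<close>] by simp
    ultimately have "0 \<le> (running_cost ?a1 - running_cost (\<alpha> j)) + (running_cost ?a2 - running_cost (\<alpha> ?k))"
      using dt_pos by (simp only: discrete_cost_dt add_le_cancel_left mult_le_cancel_left_pos)
    then have "0 \<le> \<epsilon> / dt * L2_inner (\<alpha> j) w + (\<epsilon> / dt)\<^sup>2 / 2 * L2_inner w w
        + L2_inner (\<alpha> ?k) z + 1/2 * L2_inner z z"
      unfolding running_cost_add[OF \<alpha>(1)[THEN fe_space_in_L2] w[THEN fe_space_in_L2]]
        running_cost_add[OF \<alpha>(2)[THEN fe_space_in_L2] z(1)[THEN fe_space_in_L2]]
      by simp
    also have "(\<epsilon> / dt)\<^sup>2 / 2 * L2_inner w w = (1 / dt)\<^sup>2 / 2 * L2_inner w w * \<epsilon>\<^sup>2"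
      by (simp add: power_divide)
    finally have "0 \<le> \<epsilon> / dt * L2_inner (\<alpha> j) w + (1 / dt)\<^sup>2 / 2 * L2_inner w w * \<epsilon>\<^sup>2
        + (\<epsilon> * L + B * \<epsilon>\<^sup>2) + 1/2 * (B * \<epsilon>\<^sup>2)"
      using z_bounds by linarith
    then show "0 \<le> \<epsilon> * (L2_inner (\<alpha> j) w / dt + L) + Q * \<epsilon>\<^sup>2"
      by (simp add: Q_def algebra_simps)
  qed
  then have "dt * (L2_inner (\<alpha> j) w / dt + L) = 0" by simp
  moreover have "dt * (L2_inner (\<alpha> j) w / dt) = L2_inner (\<alpha> j) w"
    and "dt * (1 / dt * L2_inner w (\<alpha> ?k)) = L2_inner w (\<alpha> ?k)"
    using dt_pos by simp_all
  ultimately show ?thesis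
    unfolding L_def L2_inner_commute[of "\<alpha> ?k" w] by (simp add: algebra_simps)
qed

text \<open>Moving the final state trades terminal cost against the running cost of the last control.\<close>

lemma stationarity_terminal:
  assumes N: "N = Suc j" and w: "w \<in> fe_space M"
  shows "L2_inner (\<alpha> j) w = - 2 * K * L2_inner (\<lambda>x. \<phi> N x - \<phi>m x) w"
proof -
  have "j < N" using N by simp
  have \<alpha>: "\<alpha> j \<in> fe_space M" and \<phi>: "\<phi> N \<in> fe_space M"
    using control_fe state_fe N by auto
  let ?d = "\<lambda>x. \<phi> N x - \<phi>m x"
  have d: "?d \<in> L2"
    using L2_lincomb[OF fe_space_in_L2[OF \<phi>] \<phi>m_L2, of 1 "-1"] by simp
  have zero: "(\<lambda>x. 0) \<in> fe_space M"
    using function_subspace_fe_space by (simp add: function_subspace_def)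
  \<comment> \<open>The absolute value makes the quadratic coefficient nonnegative.\<close>
  define Q where "Q = (\<bar>K\<bar> + dt / 2 * (1 / dt)\<^sup>2) * L2_inner w w"
  have "2 * K * L2_inner ?d w + L2_inner (\<alpha> j) w = 0"
  proof (rule stationary_if_quadratic_lower_bound)
    show "0 \<le> Q" using less_imp_le[OF dt_pos] L2_inner_self_nonneg[of w]
      unfolding Q_def by (intro mult_nonneg_nonneg add_nonneg_nonneg) auto
    fix \<epsilon> :: real
    let ?a1 = "\<lambda>x. \<alpha> j x + \<epsilon> / dt * w x" and ?a2 = "\<lambda>x. \<alpha> (Suc j) x + 1 * (\<lambda>x. 0) x"
    let ?\<alpha> = "\<alpha>(j := ?a1, Suc j := ?a2)" and ?\<phi> = "\<phi>(Suc j := \<lambda>x. \<phi> (Suc j) x + \<epsilon> * w x)"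
    have "admissible \<delta> T V M N 0 \<phi>0 ?\<alpha> ?\<phi>"
      by (rule perturbed_admissible[OF adm \<open>j < N\<close> w zero]) (simp add: N)
    then have "discrete_cost T K \<phi>m N 0 \<alpha> \<phi> \<le> discrete_cost T K \<phi>m N 0 ?\<alpha> ?\<phi>"
      by (rule minimal)
    moreover have "terminal_cost K \<phi>m (?\<phi> N) = terminal_cost K \<phi>m (\<phi> N)
        + K * (2 * \<epsilon> * L2_inner ?d w + \<epsilon>\<^sup>2 * L2_inner w w)"
      using L2_inner_self_add[OF d fe_space_in_L2[OF w], of \<epsilon>]
      by (simp add: terminal_cost_def L2_norm_power2 N algebra_simps)
    moreover have "(\<Sum>n=0..<N. running_cost (?\<alpha> n)) = (\<Sum>n=0..<N. running_cost (\<alpha> n))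
        + (running_cost ?a1 - running_cost (\<alpha> j))"
      unfolding sum_fun_upd_atLeastLessThan[OF \<open>j < N\<close>, symmetric]
      by (rule sum.cong) (auto simp: N)
    moreover have "dt * (\<epsilon> / dt * L2_inner (\<alpha> j) w) = \<epsilon> * L2_inner (\<alpha> j) w"
      using dt_pos by simp
    moreover have "dt * ((\<epsilon> / dt)\<^sup>2 / 2 * L2_inner w w)
        = dt / 2 * (1 / dt)\<^sup>2 * L2_inner w w * \<epsilon>\<^sup>2"
      by (simp add: power_divide mult.commute mult.left_commute)
    ultimately have "0 \<le> K * (2 * \<epsilon> * L2_inner ?d w + \<epsilon>\<^sup>2 * L2_inner w w)
        + \<epsilon> * L2_inner (\<alpha> j) w + dt / 2 * (1 / dt)\<^sup>2 * L2_inner w w * \<epsilon>\<^sup>2"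
      unfolding discrete_cost_dt
        running_cost_add[OF \<alpha>[THEN fe_space_in_L2] w[THEN fe_space_in_L2]]
      by (simp only: distrib_left right_diff_distrib)
    moreover have "K * (\<epsilon>\<^sup>2 * L2_inner w w) \<le> \<bar>K\<bar> * (\<epsilon>\<^sup>2 * L2_inner w w)"
      by (intro mult_right_mono) (auto simp: L2_inner_self_nonneg)
    ultimately show "0 \<le> \<epsilon> * (2 * K * L2_inner ?d w + L2_inner (\<alpha> j) w) + Q * \<epsilon>\<^sup>2"
      by (simp add: Q_def algebra_simps)
  qed
  then show ?thesis by simp
qed

lemma costate_terminal:
  assumes "N = Suc j"
  shows "(\<lambda>x. - \<alpha> j x) = (\<lambda>x. 2 * K * (\<phi> N x - L2_proj M \<phi>m x))"
proof (rule fe_space_eqI)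
  have \<alpha>: "\<alpha> j \<in> fe_space M" and \<phi>: "\<phi> N \<in> fe_space M"
    using control_fe state_fe assms by auto
  note P = L2_proj_fe_space[OF M_pos \<phi>m_L2]
  show "(\<lambda>x. - \<alpha> j x) \<in> fe_space M"
    using fe_space_lincomb[OF \<alpha> \<alpha>, of "-1" 0] by simp
  show "(\<lambda>x. 2 * K * (\<phi> N x - L2_proj M \<phi>m x)) \<in> fe_space M"
    using fe_space_lincomb[OF \<phi> P(1), of "2 * K" "- 2 * K"] by (simp add: algebra_simps)
  fix w assume w: "w \<in> fe_space M"
  note L2 = \<alpha>[THEN fe_space_in_L2] \<phi>[THEN fe_space_in_L2] P(1)[THEN fe_space_in_L2]
    w[THEN fe_space_in_L2]
  have "L2_inner (\<lambda>x. - \<alpha> j x) w = - L2_inner (\<alpha> j) w"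
    using L2_inner_lincomb_left[OF L2(1,1,4), of "-1" 0] by simp
  also have "\<dots> = 2 * K * L2_inner (\<lambda>x. \<phi> N x - \<phi>m x) w"
    using stationarity_terminal[OF assms w] by simp
  also have "L2_inner (\<lambda>x. \<phi> N x - \<phi>m x) w = L2_inner (\<phi> N) w - L2_inner \<phi>m w"
    using L2_inner_lincomb_left[OF L2(2) \<phi>m_L2 L2(4), of 1 "-1"] by simp
  also have "2 * K * (L2_inner (\<phi> N) w - L2_inner \<phi>m w)
      = L2_inner (\<lambda>x. 2 * K * (\<phi> N x - L2_proj M \<phi>m x)) w"
    using L2_inner_lincomb_left[OF L2(2,3,4), of "2 * K" "- 2 * K"] P(2)[OF w]
    by (simp add: algebra_simps)
  finally show "L2_inner (\<lambda>x. - \<alpha> j x) w = L2_inner (\<lambda>x. 2 * K * (\<phi> N x - L2_proj M \<phi>m x)) w" .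
qed

lemma symplectic_euler_of_minimizer:
  "\<exists>p. symplectic_euler \<delta> T K V \<phi>m M N \<phi>0 \<phi> p \<and> (\<forall>n<N. p (n+1) = (\<lambda>x. - \<alpha> n x))"
proof -
  have neg_fe: "(\<lambda>x. - \<alpha> n x) \<in> fe_space M" if "n < N" for n
    using fe_space_lincomb[OF control_fe[OF that] control_fe[OF that], of "-1" 0] by simp
  have neg_inner: "L2_inner (\<lambda>x. - \<alpha> n x) v = - L2_inner (\<alpha> n) v"
    if "n < N" "v \<in> L2" for n v
    using L2_inner_lincomb_left[of "\<alpha> n" "\<alpha> n" v "-1" 0] that
      fe_space_in_L2[OF control_fe[OF that(1)]] by simp
  have neg_deriv: "L2_inner (deriv (\<lambda>x. - \<alpha> n x)) (deriv v) = - L2_inner (deriv v) (deriv (\<alpha> n))"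
    if n: "n < N" and v: "v \<in> fe_space M" for n v
    using L2_inner_deriv_lincomb_left[OF M_pos control_fe[OF n] control_fe[OF n]
        fe_space_deriv_in_L2[OF M_pos v], of "-1" 0]
    by (simp add: L2_inner_commute)
  have neg_reaction: "L2_inner (\<lambda>x. - \<alpha> n x * (deriv ^^ 2) V (\<phi> k x)) v
      = - L2_inner (\<lambda>x. (deriv ^^ 2) V (\<phi> k x) * v x) (\<alpha> n)" for n k v
    by (simp add: L2_inner_def mult.commute mult.left_commute)
  \<comment> \<open>The state at time \<open>0\<close> is prescribed, so no variation yields the dual variable there; it is
    constructed by solving its equation.\<close>
  obtain p0 where p0: "p0 \<in> fe_space M" "\<And>v. v \<in> fe_space M \<Longrightarrow> L2_inner p0 v =
      - 1 * L2_inner (\<alpha> 0) v + dt * \<delta> * L2_inner (deriv (\<alpha> 0)) (deriv v)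
      + dt / \<delta> * L2_inner (\<lambda>x. (deriv ^^ 2) V (\<phi> 0 x) * \<alpha> 0 x) v"
    using linearized_step_riesz[OF state_fe[of 0] control_fe[OF N_pos]] by blast
  define p where "p n = (case n of 0 \<Rightarrow> p0 | Suc j \<Rightarrow> (\<lambda>x. - \<alpha> j x))" for n
  have p_Suc: "p (Suc n) = (\<lambda>x. - \<alpha> n x)" for n by (simp add: p_def)
  have "L2_inner (p n) v = L2_inner (p (n+1)) v
          + dt * (- \<delta> * L2_inner (deriv (p (n+1))) (deriv v)
               - 1/\<delta> * L2_inner (\<lambda>x. p (n+1) x * (deriv ^^ 2) V (\<phi> n x)) v)"
    if n: "n < N" and v: "v \<in> fe_space M" for n v
  proof -
    have "L2_inner (p n) v = - L2_inner (\<alpha> n) v + dt * (\<delta> * L2_inner (deriv v) (deriv (\<alpha> n))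
      + 1/\<delta> * L2_inner (\<lambda>x. (deriv ^^ 2) V (\<phi> n x) * v x) (\<alpha> n))"
    proof (cases n)
      case 0
      have "L2_inner (\<lambda>x. (deriv ^^ 2) V (\<phi> 0 x) * \<alpha> 0 x) v
          = L2_inner (\<lambda>x. (deriv ^^ 2) V (\<phi> 0 x) * v x) (\<alpha> 0)"
        by (simp add: L2_inner_def mult.commute mult.left_commute)
      then show ?thesis
        using p0(2)[OF v] 0
        by (simp add: p_def L2_inner_commute[of "deriv v"] algebra_simps)
    next
      case (Suc j)
      with n have j: "j < N" "Suc j < N" by auto
      show ?thesis
        unfolding Suc p_Suc neg_inner[OF j(1) fe_space_in_L2[OF v]]
          stationarity_interior[OF j(2) v] by simp
    qed
    then show ?thesis
      unfolding Suc_eq_plus1[symmetric] p_Suc neg_inner[OF n fe_space_in_L2[OF v]]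
        neg_deriv[OF n v] neg_reaction by simp
  qed
  moreover have "L2_inner (\<phi> (n+1)) v = L2_inner (\<phi> n) v
          + dt * (- \<delta> * L2_inner (deriv (\<phi> n)) (deriv v)
               - 1/\<delta> * L2_inner (\<lambda>x. deriv V (\<phi> n x)) v - L2_inner (p (n+1)) v)"
    if n: "n < N" and v: "v \<in> fe_space M" for n v
  proof -
    have "L2_inner (\<phi> (n+1)) v = L2_inner (\<phi> n) v
          + dt * (- \<delta> * L2_inner (deriv (\<phi> n)) (deriv v)
               + L2_inner (\<lambda>x. - (1/\<delta>) * deriv V (\<phi> n x) + \<alpha> n x) v)"
      using adm n v by (auto simp: admissible_def discrete_state_def dt_def)
    then show ?thesis
      unfolding L2_inner_drift[OF state_fe[OF less_imp_le[OF n]] control_fe[OF n] v]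
        Suc_eq_plus1[symmetric] p_Suc neg_inner[OF n fe_space_in_L2[OF v]] by simp
  qed
  moreover have "p n \<in> fe_space M" if "n \<le> N" for n
    using that p0(1) neg_fe by (cases n) (auto simp: p_def)
  moreover have "p N = (\<lambda>x. 2 * K * (\<phi> N x - L2_proj M \<phi>m x))"
    using costate_terminal[of "N - 1"] N_pos p_Suc[of "N - 1"] by simp
  moreover have "\<phi> 0 = \<phi>0" using adm by (simp add: admissible_def discrete_state_def)
  ultimately have "symplectic_euler \<delta> T K V \<phi>m M N \<phi>0 \<phi> p"
    using state_fe unfolding symplectic_euler_def dt_def[symmetric] by blast
  then show ?thesis using p_Suc by auto
qed

end

end

theorem theorem4p5:
  fixes \<delta> T K s :: real and r M N :: nat
    and V \<phi>m \<phi>0 :: "real \<Rightarrow> real"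
    and \<alpha> :: "nat \<Rightarrow> real \<Rightarrow> real"
  assumes "\<delta> > 0" and "T > 0" and "K > 0"
    and "s > 0" and "r \<ge> 3" and "modified_double_well V s r"
    and "negative_minimizer \<delta> V \<phi>m"
    and "M > 0" and "N > 0"
    and "\<phi>0 \<in> fe_space M"
    and "discrete_minimizer \<delta> T K V \<phi>m M N \<phi>0 0 \<alpha>"
  shows "\<exists>\<phi> p. symplectic_euler \<delta> T K V \<phi>m M N \<phi>0 \<phi> p \<and>
               (\<forall>n<N. p (n+1) = (\<lambda>x. - \<alpha> n x))"
proof -
  have "\<phi>m \<in> L2"
    using assms(7) by (auto simp: negative_minimizer_def H10_def H1_def)
  with assms interpret discrete_control \<delta> T K s r M N V \<phi>m
    by unfold_locales
  obtain \<phi> where "admissible \<delta> T V M N 0 \<phi>0 \<alpha> \<phi>"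
    and "\<And>\<alpha>' \<phi>'. admissible \<delta> T V M N 0 \<phi>0 \<alpha>' \<phi>' \<Longrightarrow>
      discrete_cost T K \<phi>m N 0 \<alpha> \<phi> \<le> discrete_cost T K \<phi>m N 0 \<alpha>' \<phi>'"
    using assms(11) unfolding discrete_minimizer_def by blast
  from symplectic_euler_of_minimizer[OF this] show ?thesis by blast
qed

end
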